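(* Let $r\ge1$, $m\ge1$, $\delta\ge3$, $\Delta$ be integers. Let $\mathcal{C}'$ be an $((n'=mr+\delta-1+\Delta,\ k'=mr,\ d),(\alpha,\beta))$ exact-repair MSR code over $\mathbb{F}_q$ with $d\le n'-\Delta-1=mr+\delta-2$, having systematic generator matrix $G'=[\,I_{mr\alpha}\mid Q\mid Q'\,]$, where $Q$ has size $mr\alpha\times(\delta-1)\alpha$ and $Q'$ has size $mr\alpha\times\Delta\alpha$. Partition $Q$ into consecutive row blocks $Q_1,\dots,Q_m$ (top to bottom), each of size $r\alpha\times(\delta-1)\alpha$. Let $\mathcal{C}$ be the vector code with vector-size parameter $\alpha$ and generator matrix $$G=\left[\begin{array}{ccccc|c}I_{r\alpha}&Q_1&&&&\\&&\ddots&&&Q'\\&&&I_{r\alpha}&Q_m&\end{array}\right],$$ i.e. $G=[\,\mathrm{diag}([I_{r\alpha}\mid Q_1],\dots,[I_{r\alpha}\mid Q_m])\mid Q'\,]$. Then $\mathcal{C}$ is an MSR-local code with $(r,\delta)$ information locality and with parameters (a) $K=mr\alpha$, $n=m(r+\delta-1)+\Delta$, $\alpha=(d-mr+1)\beta$; (b) $d_{\min}=n-\frac{K}{\alpha}+1-\left(\frac{K}{r\alpha}-1\right)(\delta-1).$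
   Context: Vector codes. An $\mathbb{F}_q$-linear vector code $\mathcal{C}$ of block length $n$ with vector-size parameter $\alpha$ is an $\mathbb{F}_q$-linear subspace of $(\mathbb{F}_q^\alpha)^n$; its scalar dimension is $K=\dim_{\mathbb{F}_q}\mathcal{C}$. Its generator matrix $G$ is a $K\times n\alpha$ generator matrix of the scalar code obtained by expanding each vector symbol; columns $(i-1)\alpha+1,\dots,i\alpha$ form the $i$-th thick column, associated with the $i$-th vector symbol. Standing assumption: the $\alpha$ columns in each thick column are linearly independent. For $S\subseteq[n]$, $G|_S$ is the restriction to thick columns in $S$, and $\mathcal{C}|_S$ the punctured code (restriction of codewords to $S$). $d_{\min}$ is the minimum Hamming weight, counted in vector symbols, of a nonzero codeword. MSR codes. A linear exact-repair $((n,k,d),(\alpha,\beta),B)$ regenerating code over $\mathbb{F}_q$ ($k\le d\le n-1$) is a vector code of block length $n$, vector-size parameter $\alpha$ and scalar dimension $B$ such that (i) every codeword is determined by any $k$ of its vector symbols; (ii) for every $i\in[n]$ and every set $D\subseteq[n]\setminus\{i\}$ with $|D|=d$ there are $\mathbb{F}_q$-linear maps $\varphi_h:\mathbb{F}_q^\alpha\to\mathbb{F}_q^\beta$, $h\in D$, such that for every codeword $\mathbf{c}$ the symbol $\mathbf{c}_i$ is determined by $(\varphi_h(\mathbf{c}_h))_{h\in D}$. It is an MSR code if $B=k\alpha$ and $\alpha=(d-k+1)\beta$. An MSR code with parameters $(n,k,d)$ is called an $(n,k,d)$-MSR code. Locality. $\mathcal{C}$ has $(r,\delta)$ information locality if there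 are sets $S_i\subseteq[n]$, $i\in\mathcal{L}$, with $|S_i|\le r+\delta-1$, $d_{\min}(\mathcal{C}|_{S_i})\ge\delta$, and $\mathrm{Rank}(G|_{\cup_iS_i})=K$; the $\mathcal{C}|_{S_i}$ are the local codes. $\mathcal{C}$ (with $(r,\delta)$ information locality) is an MSR-local code with $(r,\delta)$ information locality if it can be punctured to yield $m$ local codes $\mathcal{C}_i=\mathcal{C}|_{S_i}$, each an $(n_L,r,d_L)$-MSR code with $n_L=r+\delta-1$ for some repair degree $d_L$, such that $\mathrm{Rank}(G|_{\cup_{i=1}^mS_i})=K$. *)

theory Defs
  imports Complex_Main "Jordan_Normal_Form.DL_Rank" "Jordan_Normal_Form.DL_Submatrix"
begin

text \<open>
  A codeword of \<open>(F\<^sup>\<alpha>)\<^sup>n\<close> is stored in expanded form, as a scalar vector of length \<open>n * \<alpha>\<close>.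
  Symbols and thick columns are numbered from 0, so symbol \<open>i\<close> occupies the scalar positions
  \<open>i * \<alpha>, \<dots>, i * \<alpha> + \<alpha> - 1\<close>.
\<close>

definition symbol :: "nat \<Rightarrow> 'a vec \<Rightarrow> nat \<Rightarrow> 'a vec" where
  "symbol \<alpha> c i = vec \<alpha> (\<lambda>j. c $ (i * \<alpha> + j))"

definition thick_cols :: "nat \<Rightarrow> nat set \<Rightarrow> nat set" where
  "thick_cols \<alpha> S = {j. j div \<alpha> \<in> S}"

definition restrict_mat :: "nat \<Rightarrow> nat set \<Rightarrow> 'a mat \<Rightarrow> 'a mat" where
  "restrict_mat \<alpha> S G = submatrix G UNIV (thick_cols \<alpha> S)"

text \<open>The symbols in \<open>S\<close> are kept in increasing order, so that \<open>restrict_code \<alpha> S C\<close> has block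
  length \<open>card S\<close>, with symbols renumbered \<open>0, \<dots>, card S - 1\<close>.\<close>

definition restrict_code :: "nat \<Rightarrow> nat set \<Rightarrow> 'a vec set \<Rightarrow> 'a vec set" where
  "restrict_code \<alpha> S C = (\<lambda>c. vec (card S * \<alpha>) (\<lambda>j. c $ pick (thick_cols \<alpha> S) j)) ` C"

definition generator_matrix :: "nat \<Rightarrow> nat \<Rightarrow> 'a::field mat \<Rightarrow> 'a vec set \<Rightarrow> bool" where
  "generator_matrix n \<alpha> G C \<longleftrightarrow>
     dim_col G = n * \<alpha> \<and>
     distinct (rows G) \<and>
     LinearCombinations.module.lin_indpt class_ring (module_vec TYPE('a) (n * \<alpha>)) (set (rows G)) \<and>
     vec_space.row_space (n * \<alpha>) G = C"

definition scalar_dim :: "nat \<Rightarrow> nat \<Rightarrow> 'a::field vec set \<Rightarrow> nat" where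
  "scalar_dim n \<alpha> C =
     vectorspace.dim class_ring ((module_vec TYPE('a) (n * \<alpha>))\<lparr>carrier := C\<rparr>)"

text \<open>The last conjunct is the standing assumption that the columns of each thick column of a
  generator matrix are linearly independent; it does not depend on the choice of the matrix.\<close>

definition vector_code :: "nat \<Rightarrow> nat \<Rightarrow> 'a::field vec set \<Rightarrow> bool" where
  "vector_code n \<alpha> C \<longleftrightarrow>
     0 < \<alpha> \<and>
     VectorSpace.subspace class_ring C (module_vec TYPE('a) (n * \<alpha>)) \<and>
     (\<forall>G. generator_matrix n \<alpha> G C \<longrightarrow>
        (\<forall>i<n. distinct (cols (restrict_mat \<alpha> {i} G)) \<and>
           LinearCombinations.module.lin_indpt class_ring (module_vec TYPE('a) (dim_row G))
             (set (cols (restrict_mat \<alpha> {i} G)))))"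

definition hamming_weight :: "nat \<Rightarrow> nat \<Rightarrow> 'a::zero vec \<Rightarrow> nat" where
  "hamming_weight n \<alpha> c = card {i. i < n \<and> symbol \<alpha> c i \<noteq> 0\<^sub>v \<alpha>}"

text \<open>For the zero code this is \<open>Inf {} = 0\<close>, so for \<open>\<delta> \<ge> 1\<close> a zero code never counts as
  a local code below.\<close>

definition min_dist :: "nat \<Rightarrow> nat \<Rightarrow> 'a::zero vec set \<Rightarrow> nat" where
  "min_dist n \<alpha> C = Inf (hamming_weight n \<alpha> ` (C - {0\<^sub>v (n * \<alpha>)}))"

definition regenerating_code ::
    "nat \<Rightarrow> nat \<Rightarrow> nat \<Rightarrow> nat \<Rightarrow> nat \<Rightarrow> nat \<Rightarrow> 'a::field vec set \<Rightarrow> bool" where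
  "regenerating_code n k d \<alpha> \<beta> B C \<longleftrightarrow>
     k \<le> d \<and> d < n \<and> vector_code n \<alpha> C \<and> scalar_dim n \<alpha> C = B \<and>
     (\<forall>S. S \<subseteq> {..<n} \<and> card S = k \<longrightarrow>
        (\<forall>c\<in>C. \<forall>c'\<in>C. (\<forall>i\<in>S. symbol \<alpha> c i = symbol \<alpha> c' i) \<longrightarrow> c = c')) \<and>
     (\<forall>i<n. \<forall>D. D \<subseteq> {..<n} - {i} \<and> card D = d \<longrightarrow>
        (\<exists>\<phi> :: nat \<Rightarrow> 'a vec \<Rightarrow> 'a vec.
           (\<forall>h\<in>D. linear_map class_ring (module_vec TYPE('a) \<alpha>) (module_vec TYPE('a) \<beta>) (\<phi> h)) \<and>
           (\<forall>c\<in>C. \<forall>c'\<in>C. (\<forall>h\<in>D. \<phi> h (symbol \<alpha> c h) = \<phi> h (symbol \<alpha> c' h)) \<longrightarrow>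
              symbol \<alpha> c i = symbol \<alpha> c' i)))"

definition msr_code :: "nat \<Rightarrow> nat \<Rightarrow> nat \<Rightarrow> nat \<Rightarrow> nat \<Rightarrow> 'a::field vec set \<Rightarrow> bool" where
  "msr_code n k d \<alpha> \<beta> C \<longleftrightarrow>
     regenerating_code n k d \<alpha> \<beta> (k * \<alpha>) C \<and> \<alpha> = (d - k + 1) * \<beta>"

text \<open>The sets \<open>S i\<close>, \<open>i \<in> L\<close>, are the supports of local codes witnessing \<open>(r, \<delta>)\<close> information
  locality. The rank does not depend on the choice of the generator matrix.\<close>

definition local_supports ::
    "nat \<Rightarrow> nat \<Rightarrow> nat \<Rightarrow> nat \<Rightarrow> 'a::field vec set \<Rightarrow> nat set \<Rightarrow> (nat \<Rightarrow> nat set) \<Rightarrow> bool" where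
  "local_supports n \<alpha> r \<delta> C L S \<longleftrightarrow>
     (\<forall>i\<in>L. S i \<subseteq> {..<n} \<and> card (S i) \<le> r + \<delta> - 1 \<and>
        min_dist (card (S i)) \<alpha> (restrict_code \<alpha> (S i) C) \<ge> \<delta>) \<and>
     (\<exists>G. generator_matrix n \<alpha> G C \<and>
        vec_space.rank (dim_row G) (restrict_mat \<alpha> (\<Union>i\<in>L. S i) G) = scalar_dim n \<alpha> C)"

definition information_locality ::
    "nat \<Rightarrow> nat \<Rightarrow> nat \<Rightarrow> nat \<Rightarrow> 'a::field vec set \<Rightarrow> bool" where
  "information_locality n \<alpha> r \<delta> C \<longleftrightarrow> vector_code n \<alpha> C \<and> (\<exists>L S. local_supports n \<alpha> r \<delta> C L S)"

definition msr_local_code ::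
    "nat \<Rightarrow> nat \<Rightarrow> nat \<Rightarrow> nat \<Rightarrow> nat \<Rightarrow> nat \<Rightarrow> 'a::field vec set \<Rightarrow> bool" where
  "msr_local_code n m r \<delta> \<alpha> \<beta> C \<longleftrightarrow>
     information_locality n \<alpha> r \<delta> C \<and>
     (\<exists>d\<^sub>L S. local_supports n \<alpha> r \<delta> C {..<m} S \<and>
        (\<forall>i<m. card (S i) = r + \<delta> - 1 \<and>
           msr_code (r + \<delta> - 1) r d\<^sub>L \<alpha> \<beta> (restrict_code \<alpha> (S i) C)))"

definition append_cols :: "'a::zero mat \<Rightarrow> 'a mat \<Rightarrow> 'a mat" (infixr "@\<^sub>c" 65) where
  "A @\<^sub>c B = four_block_mat A B (0\<^sub>m 0 (dim_col A)) (0\<^sub>m 0 (dim_col B))"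

text \<open>The \<open>i\<close>-th of the consecutive row blocks of height \<open>h\<close>, with \<open>i\<close> counted from 0.\<close>

definition row_block :: "nat \<Rightarrow> nat \<Rightarrow> 'a mat \<Rightarrow> 'a mat" where
  "row_block h i A = mat h (dim_col A) (\<lambda>(a, b). A $$ (i * h + a, b))"

end

(*
  A codeword of C restricted to the i-th support is [I | Q_i] applied to the i-th message block. It is
  a codeword of C' whose message vanishes outside that block, so the local codes are shortenings of
  C' at (m - 1) r message symbols; fixing those symbols to 0 lowers both the number of determining
  symbols and the repair degree by (m - 1) r. For the minimum distance, Q u is the sum of the local
  parities Q_i u_i, so a codeword of C has at least the weight of the codeword of C' with the same
  message, which is at least \<delta> + \<Delta> by the MDS property; a message with one nonzero
  symbol attains this bound.
*)

theory Submission
  imports Defs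
begin

text \<open>The main obstacle is the standing assumption: the columns of each thick column must be
  independent for every generator matrix, both for the new code and for its local codes. The block
  form of \<open>G\<close> does not show this, because \<open>Q\<close> and \<open>Q'\<close> are
  known only through \<open>C'\<close>. It is therefore replaced by a property of the code alone:
  each symbol takes every value in F^\<alpha>. For a code with k\<alpha>-free messages this follows
  from determination by any k symbols, and finiteness of the field turns that injectivity into
  surjectivity. The bound on d has a similar origin. A local code sees its own message block and the
  parities \<open>Q\<close>, and shortening uses the other message symbols, so everything takes
  place in the first m r + \<delta> - 1 symbols of \<open>C'\<close>. The d helpers and the failed
  symbol must fit there together, which is the condition d \<le> m r + \<delta> - 2; the parities
  \<open>Q'\<close> never serve as helpers.\<close>

section \<open>Encoding maps, row spaces and rank\<close>

definition encode :: "'a::comm_semiring_0 mat \<Rightarrow> 'a vec \<Rightarrow> 'a vec" where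
  "encode A u = vec (dim_col A) (\<lambda>j. \<Sum>i<dim_row A. u $ i * A $$ (i, j))"

lemma encode_eq_transpose_mult:
  assumes "u \<in> carrier_vec (dim_row A)"
  shows "encode A u = A\<^sup>T *\<^sub>v u"
proof (rule eq_vecI)
  fix j assume "j < dim_vec (A\<^sup>T *\<^sub>v u)"
  then show "encode A u $ j = (A\<^sup>T *\<^sub>v u) $ j"
    using assms
    by (simp add: encode_def scalar_prod_def atLeast0LessThan mult.commute)
qed (simp add: encode_def)

lemma dim_encode [simp]: "dim_vec (encode A u) = dim_col A"
  by (simp add: encode_def)

lemma encode_carrier: "encode A u \<in> carrier_vec (dim_col A)"
  by (rule carrier_vecI) simp

lemma encode_zero: "encode A (0\<^sub>v (dim_row A)) = 0\<^sub>v (dim_col A)"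
  by (rule eq_vecI) (simp_all add: encode_def)

text \<open>Lets every code below be handled as the image of an explicit linear map on messages
  instead of as a span.\<close>

lemma row_space_eq_encode:
  fixes A :: "'a::field mat"
  assumes "dim_col A = N"
  shows "vec_space.row_space N A = encode A ` carrier_vec (dim_row A)"
proof -
  interpret vec_space "TYPE('a)" N .
  have "A \<in> carrier_mat (dim_row A) N" using assms by auto
  from row_space_eq[OF this] have "row_space A =
      {w \<in> carrier_vec N. \<exists>y\<in>carrier_vec (dim_row A). encode A y = w}"
    by (simp add: encode_eq_transpose_mult assms)
  moreover have "encode A y \<in> carrier_vec N" for y
    using encode_carrier[of A y] assms by simp
  ultimately show ?thesis by (auto simp: image_iff)
qed

text \<open>Independence refers to the set of columns and would hide a repeated column, so
  distinctness is a separate claim: two equal columns put the difference of two unit vectors into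
  the kernel.\<close>

lemma cols_lin_indpt_if_kernel_trivial:
  fixes A :: "'a::field mat"
  assumes A: "A \<in> carrier_mat N k"
    and ker: "\<And>v. v \<in> carrier_vec k \<Longrightarrow> A *\<^sub>v v = 0\<^sub>v N \<Longrightarrow> v = 0\<^sub>v k"
  shows "distinct (cols A) \<and>
    LinearCombinations.module.lin_indpt class_ring (module_vec TYPE('a) N) (set (cols A))"
proof -
  interpret vec_space "TYPE('a)" N .
  have dist: "distinct (cols A)"
    unfolding distinct_conv_nth
  proof (intro allI impI notI)
    fix i j assume "i < length (cols A)" "j < length (cols A)" "i \<noteq> j" "cols A ! i = cols A ! j"
    with A have ij: "i < k" "j < k" "i \<noteq> j" "col A i = col A j" by auto
    let ?v = "unit_vec k i - unit_vec k j :: 'a vec"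
    have "A *\<^sub>v ?v = A *\<^sub>v unit_vec k i - A *\<^sub>v unit_vec k j"
      using A by (intro mult_minus_distrib_mat_vec) auto
    also have "\<dots> = 0\<^sub>v N"
    proof (rule eq_vecI)
      fix a assume "a < dim_vec (0\<^sub>v N)"
      moreover have "col A i $ a = col A j $ a" using ij by simp
      ultimately show "(A *\<^sub>v unit_vec k i - A *\<^sub>v unit_vec k j) $ a = 0\<^sub>v N $ a"
        using A ij by (simp add: col_def)
    qed (use A in simp)
    finally have "?v = 0\<^sub>v k" by (intro ker) auto
    then have "?v $ i = 0\<^sub>v k $ i" by simp
    then show False using ij by simp
  qed
  have "lin_indpt (set (cols A))"
    by (rule notI, erule lin_depE[OF A _ dist]) (use ker in blast)
  with dist show ?thesis by blast
qed

text \<open>The rows of \<open>A\<close> are the columns of its transpose, and injectivity of the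
  encoding is triviality of the kernel of that transpose.\<close>

lemma generator_matrix_row_space:
  fixes A :: "'a::field mat"
  assumes dim: "dim_col A = N * \<alpha>" and inj: "inj_on (encode A) (carrier_vec (dim_row A))"
  shows "generator_matrix N \<alpha> A (vec_space.row_space (N * \<alpha>) A)"
    and "scalar_dim N \<alpha> (vec_space.row_space (N * \<alpha>) A) = dim_row A"
proof -
  interpret vec_space "TYPE('a)" "N * \<alpha>" .
  have AT: "A\<^sup>T \<in> carrier_mat (N * \<alpha>) (dim_row A)" using dim by auto
  have *: "distinct (cols A\<^sup>T) \<and> lin_indpt (set (cols A\<^sup>T))"
  proof (rule cols_lin_indpt_if_kernel_trivial[OF AT])
    fix v assume "v \<in> carrier_vec (dim_row A)" "A\<^sup>T *\<^sub>v v = 0\<^sub>v (N * \<alpha>)"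
    then have "encode A v = encode A (0\<^sub>v (dim_row A))"
      by (simp add: encode_zero encode_eq_transpose_mult[of v A] dim)
    then show "v = 0\<^sub>v (dim_row A)"
      using inj \<open>v \<in> _\<close> by (auto dest: inj_onD)
  qed
  then show "generator_matrix N \<alpha> A (row_space A)"
    using dim by (simp add: generator_matrix_def)
  show "scalar_dim N \<alpha> (row_space A) = dim_row A"
    using lin_indpt_full_rank[OF AT] *
    by (simp add: scalar_dim_def rank_def row_space_def)
qed

lemma subspace_row_space:
  fixes A :: "'a::field mat"
  assumes "dim_col A = N"
  shows "VectorSpace.subspace class_ring (vec_space.row_space N A) (module_vec TYPE('a) N)"
proof -
  interpret vec_space "TYPE('a)" N .
  have "set (rows A) \<subseteq> carrier_vec N" using assms rows_carrier by blast
  then show ?thesis unfolding row_space_def by (intro span_is_subspace) auto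
qed

lemma rank_eq_if_unit_vecs:
  fixes A :: "'a::field mat"
  assumes A: "dim_row A = N" and "set (unit_vecs N) \<subseteq> set (cols A)"
  shows "vec_space.rank N A = N"
proof -
  interpret vec_space "TYPE('a)" N .
  have c: "set (cols A) \<subseteq> carrier_vec N" using A cols_dim by blast
  have "carrier_vec N \<subseteq> span (set (cols A))"
    using span_is_monotone[OF assms(2)] span_unit_vecs_is_carrier by simp
  with c have "span (set (cols A)) = carrier V" using span_is_subset2 by fastforce
  then have "span_vs (set (cols A)) = V" by (simp add: module_vec_def)
  then show ?thesis using dim_is_n by (simp add: rank_def)
qed

text \<open>Prepares the counting argument by which an injective self-map of a space of vectors is
  onto.\<close>

lemma finite_carrier_vec: "finite (carrier_vec n :: 'a::finite vec set)"
proof (rule finite_subset)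
  show "carrier_vec n \<subseteq> vec n ` ({..<n} \<rightarrow>\<^sub>E (UNIV :: 'a set))"
  proof
    fix v :: "'a vec" assume "v \<in> carrier_vec n"
    then have "v = vec n (restrict (($) v) {..<n})" by auto
    then show "v \<in> vec n ` ({..<n} \<rightarrow>\<^sub>E (UNIV :: 'a set))"
      by (intro image_eqI[of v "vec n" "restrict (($) v) {..<n}"]) (auto simp: PiE_iff)
  qed
qed (intro finite_imageI finite_PiE; simp)

section \<open>Restriction to consecutive symbols\<close>

text \<open>All supports used below are intervals, where the increasing renumbering by
  \<open>pick\<close> is a plain shift.\<close>

lemma pick_interval:
  assumes "j < b - a"
  shows "pick {a..<b} j = a + j"
proof -
  have "{x \<in> {a..<b}. x < a + j} = {a..<a + j}" using assms by auto
  then show ?thesis using pick_card_in_set[of "a + j" "{a..<b}"] assms by simp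
qed

lemma thick_cols_interval:
  assumes "\<alpha> > 0"
  shows "thick_cols \<alpha> {a..<b} = {a * \<alpha>..<b * \<alpha>}"
  using assms by (auto simp: thick_cols_def less_eq_div_iff_mult_less_eq div_less_iff_less_mult)

lemma restrict_code_interval:
  assumes "\<alpha> > 0"
  shows "restrict_code \<alpha> {a..<b} C = (\<lambda>c. vec ((b - a) * \<alpha>) (\<lambda>j. c $ (a * \<alpha> + j))) ` C"
  unfolding restrict_code_def thick_cols_interval[OF assms]
  by (intro image_cong refl eq_vecI) (auto simp: pick_interval diff_mult_distrib)

lemma restrict_mat_interval:
  assumes "\<alpha> > 0" "b * \<alpha> \<le> dim_col G"
  shows "restrict_mat \<alpha> {a..<b} G =
    mat (dim_row G) ((b - a) * \<alpha>) (\<lambda>(i, j). G $$ (i, a * \<alpha> + j))"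
proof -
  have "{j. j < dim_col G \<and> j \<in> {a * \<alpha>..<b * \<alpha>}} = {a * \<alpha>..<b * \<alpha>}" using assms(2) by auto
  then show ?thesis
    unfolding restrict_mat_def submatrix_def thick_cols_interval[OF assms(1)]
    by (intro eq_matI) (auto simp: pick_interval pick_UNIV diff_mult_distrib)
qed

section \<open>Codes determined by any k symbols\<close>

text \<open>Clause (i) of a regenerating code, isolated because it passes to shortened codes and
  alone yields both the surjectivity of symbols and the weight bounds.\<close>

definition determined_by_any :: "nat \<Rightarrow> nat \<Rightarrow> nat \<Rightarrow> 'a vec set \<Rightarrow> bool" where
  "determined_by_any k N \<alpha> C \<longleftrightarrow> (\<forall>S. S \<subseteq> {..<N} \<and> card S = k \<longrightarrow>
     (\<forall>c\<in>C. \<forall>c'\<in>C. (\<forall>i\<in>S. symbol \<alpha> c i = symbol \<alpha> c' i) \<longrightarrow> c = c'))"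

lemma determined_by_anyD:
  assumes "determined_by_any k N \<alpha> C" "S \<subseteq> {..<N}" "card S = k" "c \<in> C" "c' \<in> C"
    and "\<And>i. i \<in> S \<Longrightarrow> symbol \<alpha> c i = symbol \<alpha> c' i"
  shows "c = c'"
  using assms unfolding determined_by_any_def by blast

text \<open>Any \<open>k\<close> symbols carry \<open>k * \<alpha>\<close> scalars and determine the
  message, so reading them off is an injective self-map of a finite set and hence onto. Those
  symbols can then be prescribed freely; symbol \<open>i\<close> is made one of them.\<close>

lemma symbol_surjective:
  fixes A :: "'a::{field,finite} mat"
  assumes dim: "dim_row A = k * \<alpha>"
    and inj: "inj_on (encode A) (carrier_vec (k * \<alpha>))"
    and det: "determined_by_any k N \<alpha> (encode A ` carrier_vec (k * \<alpha>))"
    and k: "1 \<le> k" "k \<le> N" and i: "i < N" and x: "x \<in> carrier_vec \<alpha>"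
  shows "\<exists>v\<in>carrier_vec (k * \<alpha>). symbol \<alpha> (encode A v) i = x"
proof -
  have "k - 1 \<le> card ({..<N} - {i})" using i k by simp
  then obtain S0 where S0: "S0 \<subseteq> {..<N} - {i}" "card S0 = k - 1" "finite S0"
    using obtain_subset_with_card_n by blast
  define S where "S = insert i S0"
  have S: "S \<subseteq> {..<N}" "card S = k" "i \<in> S" "finite S"
    using S0 k i by (auto simp: S_def card_insert_if)
  then obtain e where e: "bij_betw e {..<k} S"
    using ex_bij_betw_nat_finite[of S] by (auto simp: atLeast0LessThan)
  \<comment> \<open>The symbols at \<open>S\<close>, in the order of the enumeration
    \<open>e\<close>, glued into one vector of the length of a message.\<close>
  define \<psi> where "\<psi> v = vec (k * \<alpha>) (\<lambda>j. symbol \<alpha> (encode A v) (e (j div \<alpha>)) $ (j mod \<alpha>))" for v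
  have "inj_on \<psi> (carrier_vec (k * \<alpha>))"
  proof (rule inj_onI)
    fix v w :: "'a vec"
    assume v: "v \<in> carrier_vec (k * \<alpha>)" and w: "w \<in> carrier_vec (k * \<alpha>)" and eq: "\<psi> v = \<psi> w"
    have "encode A v = encode A w"
    proof (rule determined_by_anyD[OF det S(1,2)])
      fix s assume "s \<in> S"
      then obtain h where h: "h < k" "s = e h" using e by (auto simp: bij_betw_def)
      show "symbol \<alpha> (encode A v) s = symbol \<alpha> (encode A w) s"
      proof (rule eq_vecI)
        fix j assume "j < dim_vec (symbol \<alpha> (encode A w) s)"
        then have j: "j < \<alpha>" by (simp add: symbol_def)
        have "h * \<alpha> + j < Suc h * \<alpha>" using j by simp
        also have "\<dots> \<le> k * \<alpha>" using h by (intro mult_le_mono1) simp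
        finally have lt: "h * \<alpha> + j < k * \<alpha>" .
        have "\<psi> v $ (h * \<alpha> + j) = \<psi> w $ (h * \<alpha> + j)" using eq by simp
        then show "symbol \<alpha> (encode A v) s $ j = symbol \<alpha> (encode A w) s $ j"
          using lt j h by (simp add: \<psi>_def)
      qed (simp add: symbol_def)
    qed (use v w in auto)
    then show "v = w" using inj v w by (auto dest: inj_onD)
  qed
  moreover have "\<psi> ` carrier_vec (k * \<alpha>) \<subseteq> carrier_vec (k * \<alpha>)" by (auto simp: \<psi>_def)
  ultimately have surj: "\<psi> ` carrier_vec (k * \<alpha>) = carrier_vec (k * \<alpha>)"
    by (intro endo_inj_surj finite_carrier_vec)
  \<comment> \<open>The target repeats \<open>x\<close> in all \<open>k\<close> symbols, so it does
    not matter at which place of the enumeration \<open>i\<close> occurs.\<close>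
  have "vec (k * \<alpha>) (\<lambda>j. x $ (j mod \<alpha>)) \<in> \<psi> ` carrier_vec (k * \<alpha>)" unfolding surj by simp
  then obtain v where v: "v \<in> carrier_vec (k * \<alpha>)" "\<psi> v = vec (k * \<alpha>) (\<lambda>j. x $ (j mod \<alpha>))"
    by auto
  obtain h where h: "h < k" "i = e h" using e S(3) by (auto simp: bij_betw_def)
  have "symbol \<alpha> (encode A v) i = x"
  proof (rule eq_vecI)
    fix j assume "j < dim_vec x"
    then have j: "j < \<alpha>" using x by simp
    have "h * \<alpha> + j < Suc h * \<alpha>" using j by simp
    also have "\<dots> \<le> k * \<alpha>" using h by (intro mult_le_mono1) simp
    finally have lt: "h * \<alpha> + j < k * \<alpha>" .
    have "\<psi> v $ (h * \<alpha> + j) = vec (k * \<alpha>) (\<lambda>j. x $ (j mod \<alpha>)) $ (h * \<alpha> + j)" using v by simp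
    then show "symbol \<alpha> (encode A v) i $ j = x $ j" using lt j h by (simp add: \<psi>_def)
  qed (use x in \<open>simp add: symbol_def\<close>)
  with v show ?thesis by blast
qed

text \<open>Duality between a thick column and the symbol it produces: a kernel vector of the thick
  column is orthogonal to that symbol in every codeword.\<close>

lemma symbol_scalar_prod:
  assumes dim: "dim_col G = N * \<alpha>" and i: "i < N" and \<alpha>: "\<alpha> > 0"
    and u: "u \<in> carrier_vec (dim_row G)" and x: "x \<in> carrier_vec \<alpha>"
  shows "symbol \<alpha> (encode G u) i \<bullet> x = u \<bullet> (restrict_mat \<alpha> {i} G *\<^sub>v x)"
proof -
  have "Suc i * \<alpha> \<le> N * \<alpha>" using i by (intro mult_le_mono1) simp
  then have le: "Suc i * \<alpha> \<le> dim_col G" using dim by simp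
  have R: "restrict_mat \<alpha> {i} G = mat (dim_row G) \<alpha> (\<lambda>(a, j). G $$ (a, i * \<alpha> + j))"
    using restrict_mat_interval[OF \<alpha> le, of i] by simp
  have "symbol \<alpha> (encode G u) i \<bullet> x =
      (\<Sum>j<\<alpha>. (\<Sum>a<dim_row G. u $ a * G $$ (a, i * \<alpha> + j)) * x $ j)"
    using x le by (simp add: scalar_prod_def symbol_def encode_def atLeast0LessThan)
  also have "\<dots> = (\<Sum>j<\<alpha>. \<Sum>a<dim_row G. u $ a * (G $$ (a, i * \<alpha> + j) * x $ j))"
    by (simp add: sum_distrib_right mult.assoc)
  also have "\<dots> = (\<Sum>a<dim_row G. \<Sum>j<\<alpha>. u $ a * (G $$ (a, i * \<alpha> + j) * x $ j))"
    by (rule sum.swap)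
  also have "\<dots> = u \<bullet> (restrict_mat \<alpha> {i} G *\<^sub>v x)"
    using x by (simp add: R scalar_prod_def atLeast0LessThan sum_distrib_left)
  finally show ?thesis .
qed

text \<open>A dependency among the columns of a thick column is orthogonal to all values of the
  symbol, hence to all of F^\<alpha>, hence zero. Surjectivity mentions only the code, so all
  generator matrices are covered at once.\<close>

lemma vector_code_if_symbols_surjective:
  fixes C :: "'a::field vec set"
  assumes \<alpha>: "\<alpha> > 0"
    and sub: "VectorSpace.subspace class_ring C (module_vec TYPE('a) (N * \<alpha>))"
    and surj: "\<And>i x. i < N \<Longrightarrow> x \<in> carrier_vec \<alpha> \<Longrightarrow> \<exists>c\<in>C. symbol \<alpha> c i = x"
  shows "vector_code N \<alpha> C"
  unfolding vector_code_def
proof (intro conjI \<alpha> sub allI impI)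
  fix G i assume gen: "generator_matrix N \<alpha> G C" and i: "i < N"
  have dim: "dim_col G = N * \<alpha>" and C: "C = encode G ` carrier_vec (dim_row G)"
    using gen row_space_eq_encode[of G "N * \<alpha>"] by (simp_all add: generator_matrix_def)
  have "Suc i * \<alpha> \<le> dim_col G" using i dim by (metis Suc_leI mult_le_mono1)
  then have car: "restrict_mat \<alpha> {i} G \<in> carrier_mat (dim_row G) \<alpha>"
    using restrict_mat_interval[OF \<alpha>, of "Suc i" G i] by simp
  have "distinct (cols (restrict_mat \<alpha> {i} G)) \<and>
      LinearCombinations.module.lin_indpt class_ring (module_vec TYPE('a) (dim_row G))
        (set (cols (restrict_mat \<alpha> {i} G)))"
  proof (rule cols_lin_indpt_if_kernel_trivial[OF car])
    fix x assume x: "x \<in> carrier_vec \<alpha>" and ker: "restrict_mat \<alpha> {i} G *\<^sub>v x = 0\<^sub>v (dim_row G)"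
    show "x = 0\<^sub>v \<alpha>"
    proof (rule eq_vecI)
      fix j assume "j < dim_vec (0\<^sub>v \<alpha>)"
      then have j: "j < \<alpha>" by simp
      \<comment> \<open>A codeword whose symbol \<open>i\<close> is a unit vector extracts the
        single entry \<open>x $ j\<close>.\<close>
      obtain u where u: "u \<in> carrier_vec (dim_row G)" "symbol \<alpha> (encode G u) i = unit_vec \<alpha> j"
        using surj[OF i, of "unit_vec \<alpha> j"] C by auto
      have "unit_vec \<alpha> j \<bullet> x = u \<bullet> 0\<^sub>v (dim_row G)"
        using symbol_scalar_prod[OF dim i \<alpha> u(1) x] u(2) ker by simp
      then show "x $ j = 0\<^sub>v \<alpha> $ j" using x j u(1) by (simp add: scalar_prod_left_unit)
    qed (use x in simp)
  qed
  then show "distinct (cols (restrict_mat \<alpha> {i} G))"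
    and "LinearCombinations.module.lin_indpt class_ring (module_vec TYPE('a) (dim_row G))
        (set (cols (restrict_mat \<alpha> {i} G)))" by auto
qed

text \<open>A word of weight at most \<open>N - k\<close> agrees with the zero word on
  \<open>k\<close> symbols and is therefore zero. This is the MDS lower bound.\<close>

lemma hamming_weight_ge_if_determined:
  assumes det: "determined_by_any k N \<alpha> C" and "0\<^sub>v (N * \<alpha>) \<in> C" "k \<le> N"
    and c: "c \<in> C" "c \<noteq> 0\<^sub>v (N * \<alpha>)"
  shows "N - k + 1 \<le> hamming_weight N \<alpha> c"
proof (rule ccontr)
  let ?W = "{i. i < N \<and> symbol \<alpha> c i \<noteq> 0\<^sub>v \<alpha>}"
  assume "\<not> ?thesis"
  then have "card ?W \<le> N - k" by (simp add: hamming_weight_def)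
  moreover have "card ({..<N} - ?W) = N - card ?W" by (subst card_Diff_subset) auto
  ultimately have "k \<le> card ({..<N} - ?W)" using \<open>k \<le> N\<close> by simp
  then obtain S where S: "S \<subseteq> {..<N} - ?W" "card S = k"
    using obtain_subset_with_card_n by blast
  have "c = 0\<^sub>v (N * \<alpha>)"
  proof (rule determined_by_anyD[OF det _ S(2) c(1) assms(2)])
    fix i assume "i \<in> S"
    with S have i: "i < N" "symbol \<alpha> c i = 0\<^sub>v \<alpha>" by auto
    have "Suc i * \<alpha> \<le> N * \<alpha>" using i by (intro mult_le_mono1) simp
    then show "symbol \<alpha> c i = symbol \<alpha> (0\<^sub>v (N * \<alpha>)) i"
      using i by (auto simp: symbol_def)
  qed (use S in auto)
  then show False using c by simp
qed

section \<open>Message blocks, concatenated and block-diagonal matrices\<close>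

lemma block_index_less:
  fixes h :: nat
  assumes "s < m" "a < h"
  shows "s * h + a < m * h"
proof -
  have "s * h + a < Suc s * h" using assms by simp
  also have "\<dots> \<le> m * h" using assms by (intro mult_le_mono1) simp
  finally show ?thesis .
qed

lemma sum_lessThan_blocks:
  fixes f :: "nat \<Rightarrow> 'b::comm_monoid_add"
  shows "(\<Sum>i<m * h. f i) = (\<Sum>s<m. \<Sum>a<h. f (s * h + a))"
proof -
  have "sum f {s * h..<s * h + h} = (\<Sum>a<h. f (s * h + a))" for s
    by (subst sum.atLeastLessThan_shift_0) (simp add: atLeast0LessThan)
  then show ?thesis by (simp add: sum.nat_group[symmetric])
qed

definition sub_block :: "nat \<Rightarrow> nat \<Rightarrow> 'a vec \<Rightarrow> 'a vec" where
  "sub_block h s u = vec h (\<lambda>a. u $ (s * h + a))"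

text \<open>Extends a local message to a full one, both to lift local codewords to the outer code
  and to show that every local codeword occurs in the global code.\<close>

definition inject_block :: "nat \<Rightarrow> nat \<Rightarrow> nat \<Rightarrow> 'a::zero vec \<Rightarrow> 'a vec" where
  "inject_block m h s v = vec (m * h) (\<lambda>i. if i div h = s then v $ (i mod h) else 0)"

lemma sub_block_carrier: "sub_block h s u \<in> carrier_vec h"
  by (simp add: sub_block_def)

lemma inject_block_carrier: "inject_block m h s v \<in> carrier_vec (m * h)"
  by (simp add: inject_block_def)

lemma sub_block_inject:
  assumes "t < m" "v \<in> carrier_vec h"
  shows "sub_block h t (inject_block m h s v) = (if t = s then v else 0\<^sub>v h)"
  using assms block_index_less[OF assms(1)]
  by (intro eq_vecI) (auto simp: sub_block_def inject_block_def)

lemma append_cols_carrier: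
  assumes "A \<in> carrier_mat k p" "B \<in> carrier_mat k q"
  shows "A @\<^sub>c B \<in> carrier_mat k (p + q)"
  using assms by (auto simp: append_cols_def)

lemma encode_append_cols:
  assumes "A \<in> carrier_mat k p" "B \<in> carrier_mat k q"
  shows "encode (A @\<^sub>c B) u = encode A u @\<^sub>v encode B u"
  using assms by (intro eq_vecI) (auto simp: encode_def append_cols_def)

lemma encode_one:
  assumes "u \<in> carrier_vec k"
  shows "encode (1\<^sub>m k) u = (u :: 'a::comm_semiring_1 vec)"
proof (rule eq_vecI)
  fix j assume "j < dim_vec u"
  then have j: "j < k" using assms by simp
  then show "encode (1\<^sub>m k) u $ j = u $ j" by (simp add: encode_def if_distrib cong: if_cong)
qed (use assms in simp)

lemma row_block_carrier: "row_block h s A \<in> carrier_mat h (dim_col A)"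
  by (simp add: row_block_def)

lemma encode_row_blocks:
  assumes "dim_row A = m * h" "j < dim_col A"
  shows "encode A u $ j = (\<Sum>s<m. encode (row_block h s A) (sub_block h s u) $ j)"
  using assms by (simp add: encode_def row_block_def sub_block_def sum_lessThan_blocks)

lemma encode_inject_block:
  assumes "dim_row A = m * h" "s < m" "v \<in> carrier_vec h"
  shows "encode A (inject_block m h s v) = encode (row_block h s A) v"
proof (rule eq_vecI)
  fix j assume "j < dim_vec (encode (row_block h s A) v)"
  then have j: "j < dim_col A" by (simp add: row_block_def)
  have "encode (row_block h t A) (sub_block h t (inject_block m h s v)) $ j =
      (if t = s then encode (row_block h s A) v $ j else 0)" if "t < m" for t
    using that assms(3) j encode_zero[of "row_block h t A"]
    by (simp add: sub_block_inject row_block_def)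
  then show "encode A (inject_block m h s v) $ j = encode (row_block h s A) v $ j"
    using assms(2) by (simp add: encode_row_blocks[OF assms(1) j])
qed (simp add: row_block_def)

lemma diag_block_mat_carrier:
  assumes "\<And>A. A \<in> set As \<Longrightarrow> A \<in> carrier_mat h w"
  shows "diag_block_mat As \<in> carrier_mat (length As * h) (length As * w)"
  using assms
proof (induction As)
  case (Cons A As)
  then have "A \<in> carrier_mat h w" "diag_block_mat As \<in> carrier_mat (length As * h) (length As * w)"
    by auto
  then show ?case by (simp add: Let_def)
qed simp

text \<open>All blocks have the same size, so a position is a block number with an offset. The
  induction strips the first block, which lowers both block numbers by one.\<close>

lemma diag_block_mat_index:
  assumes "\<And>A. A \<in> set As \<Longrightarrow> A \<in> carrier_mat h w"
    and "s < length As" "t < length As" "a < h" "b < w"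
  shows "diag_block_mat As $$ (s * h + a, t * w + b) = (if s = t then (As ! s) $$ (a, b) else 0)"
  using assms
proof (induction As arbitrary: s t)
  case (Cons A As)
  have A: "A \<in> carrier_mat h w" using Cons.prems by auto
  have D: "diag_block_mat As \<in> carrier_mat (length As * h) (length As * w)"
    using Cons.prems by (intro diag_block_mat_carrier) auto
  have b1: "s * h + a < length (A # As) * h" and b2: "t * w + b < length (A # As) * w"
    using Cons.prems by (auto intro!: block_index_less simp del: mult_Suc)
  then have i: "diag_block_mat (A # As) $$ (s * h + a, t * w + b) =
    (if s * h + a < h then if t * w + b < w then A $$ (s * h + a, t * w + b) else 0
     else if t * w + b < w then 0
       else diag_block_mat As $$ (s * h + a - h, t * w + b - w))"
    using A D by (auto simp: Let_def)
  show ?case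
  proof (cases s; cases t)
    fix s' t' assume st: "s = Suc s'" "t = Suc t'"
    then have "diag_block_mat (A # As) $$ (s * h + a, t * w + b) =
        diag_block_mat As $$ (s' * h + a, t' * w + b)"
      unfolding i by simp
    also have "\<dots> = (if s' = t' then (As ! s') $$ (a, b) else 0)"
      using Cons.prems st by (intro Cons.IH) auto
    finally show ?thesis using st by simp
  qed (use i Cons.prems in auto)
qed simp

lemma encode_diag_block_mat:
  assumes As: "\<And>A. A \<in> set As \<Longrightarrow> A \<in> carrier_mat h w"
    and t: "t < length As" and b: "b < w"
  shows "encode (diag_block_mat As) u $ (t * w + b) = encode (As ! t) (sub_block h t u) $ b"
proof -
  have D: "diag_block_mat As \<in> carrier_mat (length As * h) (length As * w)"
    using As by (rule diag_block_mat_carrier)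
  have At: "As ! t \<in> carrier_mat h w" using As t by simp
  have "encode (diag_block_mat As) u $ (t * w + b) =
      (\<Sum>s<length As. \<Sum>a<h. u $ (s * h + a) * diag_block_mat As $$ (s * h + a, t * w + b))"
    using D block_index_less[OF t b] by (simp add: encode_def sum_lessThan_blocks)
  also have "\<dots> = (\<Sum>s<length As. if s = t
      then \<Sum>a<h. u $ (t * h + a) * (As ! t) $$ (a, b) else 0)"
    using t b by (intro sum.cong refl) (auto simp: diag_block_mat_index[OF As])
  also have "\<dots> = encode (As ! t) (sub_block h t u) $ b"
    using t b At by (simp add: encode_def sub_block_def)
  finally show ?thesis .
qed

section \<open>Symbols of encoded messages and bounds on the minimum distance\<close>

lemma symbol_append:
  assumes "x \<in> carrier_vec (p * \<alpha>)" "y \<in> carrier_vec (q * \<alpha>)" "i < p + q"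
  shows "symbol \<alpha> (x @\<^sub>v y) i = (if i < p then symbol \<alpha> x i else symbol \<alpha> y (i - p))"
proof (rule eq_vecI)
  fix j assume "j < dim_vec (if i < p then symbol \<alpha> x i else symbol \<alpha> y (i - p))"
  then have j: "j < \<alpha>" by (auto simp: symbol_def split: if_splits)
  have lt: "i * \<alpha> + j < p * \<alpha> + q * \<alpha>"
    using block_index_less[OF assms(3) j] by (simp add: add_mult_distrib)
  show "symbol \<alpha> (x @\<^sub>v y) i $ j = (if i < p then symbol \<alpha> x i else symbol \<alpha> y (i - p)) $ j"
  proof (cases "i < p")
    case True
    then show ?thesis using j assms lt block_index_less[OF True j] by (simp add: symbol_def)
  next
    case False
    then have "p * \<alpha> \<le> i * \<alpha>" by simp
    then have "\<not> i * \<alpha> + j < p * \<alpha>" by linarith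
    then show ?thesis using False j assms lt by (simp add: symbol_def diff_mult_distrib)
  qed
qed (auto simp: symbol_def)

lemma symbol_sub_block:
  assumes "b < r"
  shows "symbol \<alpha> (sub_block (r * \<alpha>) s u) b = symbol \<alpha> u (s * r + b)"
  using block_index_less[OF assms, of _ \<alpha>]
  by (intro eq_vecI) (auto simp: symbol_def sub_block_def algebra_simps)

lemma symbol_zero:
  assumes "i < N"
  shows "symbol \<alpha> (0\<^sub>v (N * \<alpha>)) i = 0\<^sub>v \<alpha>"
  using block_index_less[OF assms, of _ \<alpha>] by (intro eq_vecI) (auto simp: symbol_def)

lemma vec_eq_if_symbols_eq:
  assumes "c \<in> carrier_vec (N * \<alpha>)" "c' \<in> carrier_vec (N * \<alpha>)"
    and "\<And>i. i < N \<Longrightarrow> symbol \<alpha> c i = symbol \<alpha> c' i"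
  shows "c = c'"
proof (rule eq_vecI)
  fix j assume "j < dim_vec c'"
  then have j: "j < N * \<alpha>" using assms by simp
  then have "\<alpha> > 0" by (cases \<alpha>) auto
  with j have "j div \<alpha> < N" "j mod \<alpha> < \<alpha>" by (auto simp: div_less_iff_less_mult)
  then have "symbol \<alpha> c (j div \<alpha>) $ (j mod \<alpha>) = symbol \<alpha> c' (j div \<alpha>) $ (j mod \<alpha>)"
    using assms(3) by simp
  with \<open>j mod \<alpha> < \<alpha>\<close> show "c $ j = c' $ j" by (simp add: symbol_def)
qed (use assms in simp)

lemma encode_systematic:
  fixes P :: "'a::comm_semiring_1 mat"
  assumes "P \<in> carrier_mat k q" "u \<in> carrier_vec k"
  shows "encode (1\<^sub>m k @\<^sub>c P) u = u @\<^sub>v encode P u"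
  using encode_append_cols[of "1\<^sub>m k" k k P q u] assms by (simp add: encode_one)

lemma symbol_systematic:
  fixes P :: "'a::comm_semiring_1 mat"
  assumes "P \<in> carrier_mat (k * \<alpha>) (q * \<alpha>)" "u \<in> carrier_vec (k * \<alpha>)" "i < k + q"
  shows "symbol \<alpha> (encode (1\<^sub>m (k * \<alpha>) @\<^sub>c P) u) i =
    (if i < k then symbol \<alpha> u i else symbol \<alpha> (encode P u) (i - k))"
  using assms encode_carrier[of P u] by (simp add: encode_systematic symbol_append)

lemma inj_encode_systematic:
  fixes P :: "'a::comm_semiring_1 mat"
  assumes "P \<in> carrier_mat k q"
  shows "inj_on (encode (1\<^sub>m k @\<^sub>c P)) (carrier_vec k)"
  by (rule inj_onI) (use assms in \<open>auto simp: encode_systematic append_vec_eq\<close>)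

lemma symbol_diag_block_mat:
  assumes "\<And>A. A \<in> set As \<Longrightarrow> A \<in> carrier_mat h (q * \<alpha>)"
    and "t < length As" "b < q"
  shows "symbol \<alpha> (encode (diag_block_mat As) u) (t * q + b) =
    symbol \<alpha> (encode (As ! t) (sub_block h t u)) b"
proof (rule eq_vecI)
  fix j assume "j < dim_vec (symbol \<alpha> (encode (As ! t) (sub_block h t u)) b)"
  then have j: "j < \<alpha>" by (simp add: symbol_def)
  have "(t * q + b) * \<alpha> + j = t * (q * \<alpha>) + (b * \<alpha> + j)"
    by (simp only: add_mult_distrib mult.assoc add.assoc)
  moreover have "encode (diag_block_mat As) u $ (t * (q * \<alpha>) + (b * \<alpha> + j)) =
      encode (As ! t) (sub_block h t u) $ (b * \<alpha> + j)"
    using assms block_index_less[OF assms(3) j] by (intro encode_diag_block_mat)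
  ultimately show "symbol \<alpha> (encode (diag_block_mat As) u) (t * q + b) $ j =
      symbol \<alpha> (encode (As ! t) (sub_block h t u)) b $ j"
    using j by (simp only: symbol_def index_vec)
qed (simp add: symbol_def)

lemma min_dist_eqI:
  assumes "c \<in> C" "c \<noteq> 0\<^sub>v (N * \<alpha>)" "hamming_weight N \<alpha> c \<le> w"
    and "\<And>c. c \<in> C \<Longrightarrow> c \<noteq> 0\<^sub>v (N * \<alpha>) \<Longrightarrow> w \<le> hamming_weight N \<alpha> c"
  shows "min_dist N \<alpha> C = w"
proof -
  have "hamming_weight N \<alpha> c = w" using assms by (intro antisym) auto
  then show ?thesis unfolding min_dist_def using assms by (intro cInf_eq_minimum) blast+
qed

text \<open>The nonzero word \<open>c\<close> excludes the zero code, whose \<open>min_dist\<close>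
  is 0, the infimum of the empty set.\<close>

lemma min_dist_geI:
  assumes "c \<in> C" "c \<noteq> 0\<^sub>v (N * \<alpha>)"
    and "\<And>c. c \<in> C \<Longrightarrow> c \<noteq> 0\<^sub>v (N * \<alpha>) \<Longrightarrow> w \<le> hamming_weight N \<alpha> c"
  shows "w \<le> min_dist N \<alpha> C"
  unfolding min_dist_def using assms by (intro cInf_greatest) auto

section \<open>Repair and determination under shortening\<close>

definition repairable_from_any :: "nat \<Rightarrow> nat \<Rightarrow> nat \<Rightarrow> nat \<Rightarrow> 'a::field vec set \<Rightarrow> bool" where
  "repairable_from_any d N \<alpha> \<beta> C \<longleftrightarrow> (\<forall>i<N. \<forall>D. D \<subseteq> {..<N} - {i} \<and> card D = d \<longrightarrow>
     (\<exists>\<phi> :: nat \<Rightarrow> 'a vec \<Rightarrow> 'a vec.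
        (\<forall>h\<in>D. linear_map class_ring (module_vec TYPE('a) \<alpha>) (module_vec TYPE('a) \<beta>) (\<phi> h)) \<and>
        (\<forall>c\<in>C. \<forall>c'\<in>C. (\<forall>h\<in>D. \<phi> h (symbol \<alpha> c h) = \<phi> h (symbol \<alpha> c' h)) \<longrightarrow>
           symbol \<alpha> c i = symbol \<alpha> c' i)))"

lemma regenerating_code_iff:
  "regenerating_code N k d \<alpha> \<beta> B C \<longleftrightarrow>
     k \<le> d \<and> d < N \<and> vector_code N \<alpha> C \<and> scalar_dim N \<alpha> C = B \<and>
     determined_by_any k N \<alpha> C \<and> repairable_from_any d N \<alpha> \<beta> C"
  unfolding regenerating_code_def determined_by_any_def repairable_from_any_def by blast

text \<open>\<open>\<iota>\<close> places the symbols of \<open>L\<close> inside \<open>C\<close>,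
  and \<open>Z\<close> holds the symbols fixed to zero. Symbols of \<open>C\<close> in neither place
  are unconstrained, so this is shortening followed by puncturing. An inclusion is enough, since
  determination and repair pass to subcodes.\<close>

definition embeds_as_shortening ::
    "nat \<Rightarrow> nat \<Rightarrow> nat \<Rightarrow> (nat \<Rightarrow> nat) \<Rightarrow> nat set \<Rightarrow> 'a::zero vec set \<Rightarrow> 'a vec set \<Rightarrow> bool" where
  "embeds_as_shortening \<alpha> p N \<iota> Z L C \<longleftrightarrow>
     inj_on \<iota> {..<p} \<and> \<iota> ` {..<p} \<subseteq> {..<N} \<and> Z \<subseteq> {..<N} - \<iota> ` {..<p} \<and>
     (\<forall>c\<in>L. \<exists>c'\<in>C. (\<forall>i<p. symbol \<alpha> c' (\<iota> i) = symbol \<alpha> c i) \<and> (\<forall>z\<in>Z. symbol \<alpha> c' z = 0\<^sub>v \<alpha>))"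

text \<open>Two words that agree on \<open>k\<close> symbols have lifts that agree there and also on
  \<open>Z\<close>, where both are zero. The lifts then coincide, and with them the original
  words.\<close>

lemma shortening_determined_by_any:
  assumes emb: "embeds_as_shortening \<alpha> p N \<iota> Z L C" and L: "L \<subseteq> carrier_vec (p * \<alpha>)"
    and det: "determined_by_any (k + card Z) N \<alpha> C"
  shows "determined_by_any k p \<alpha> L"
  unfolding determined_by_any_def
proof (intro allI impI ballI)
  fix S x y assume S: "S \<subseteq> {..<p} \<and> card S = k" and xy: "x \<in> L" "y \<in> L"
    and eq: "\<forall>i\<in>S. symbol \<alpha> x i = symbol \<alpha> y i"
  note emb = emb[unfolded embeds_as_shortening_def]
  from emb xy(1) obtain x' where x': "x' \<in> C" "\<forall>i<p. symbol \<alpha> x' (\<iota> i) = symbol \<alpha> x i"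
      "\<forall>z\<in>Z. symbol \<alpha> x' z = 0\<^sub>v \<alpha>" by blast
  from emb xy(2) obtain y' where y': "y' \<in> C" "\<forall>i<p. symbol \<alpha> y' (\<iota> i) = symbol \<alpha> y i"
      "\<forall>z\<in>Z. symbol \<alpha> y' z = 0\<^sub>v \<alpha>" by blast
  have Z: "finite Z" using emb finite_subset by blast
  have inj: "inj_on \<iota> S" using emb S inj_on_subset by blast
  have S': "finite S" using S finite_subset by blast
  have "\<iota> ` S \<inter> Z = {}" using S emb by blast
  then have "card (\<iota> ` S \<union> Z) = k + card Z"
    using Z S S' by (simp add: card_Un_disjoint card_image[OF inj])
  moreover have "\<iota> ` S \<union> Z \<subseteq> {..<N}" using S emb by blast
  moreover have "symbol \<alpha> x' j = symbol \<alpha> y' j" if "j \<in> \<iota> ` S \<union> Z" for j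
    using that
  proof
    assume "j \<in> \<iota> ` S"
    then obtain h where h: "h \<in> S" "h < p" "j = \<iota> h" using S by blast
    then show ?thesis using x'(2) y'(2) eq by simp
  qed (use x'(3) y'(3) in simp)
  ultimately have "x' = y'" using determined_by_anyD[OF det _ _ x'(1) y'(1)] by blast
  then have "symbol \<alpha> x i = symbol \<alpha> y i" if "i < p" for i
    using x'(2) y'(2) that by metis
  then show "x = y" using xy L vec_eq_if_symbols_eq[of x p \<alpha> y] by blast
qed

text \<open>Helpers in \<open>Z\<close> hold zero symbols in both lifts and so send the same data.
  Agreement of the \<open>d\<close> short helpers thus gives agreement of all
  \<open>d + card Z\<close> helpers, and the maps of \<open>C\<close>, reindexed along
  \<open>\<iota>\<close>, repair the short code.\<close>

lemma shortening_repairable_from_any: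
  assumes emb: "embeds_as_shortening \<alpha> p N \<iota> Z L C"
    and rep: "repairable_from_any (d + card Z) N \<alpha> \<beta> C"
  shows "repairable_from_any d p \<alpha> \<beta> (L :: 'a::field vec set)"
  unfolding repairable_from_any_def
proof (intro allI impI)
  fix i D assume i: "i < p" and D: "D \<subseteq> {..<p} - {i} \<and> card D = d"
  note emb = emb[unfolded embeds_as_shortening_def]
  have Z: "finite Z" using emb finite_subset by blast
  have inj: "inj_on \<iota> D" using emb D by (meson Diff_subset inj_on_subset subset_trans)
  have D': "finite D" using D finite_subset by blast
  have "\<iota> ` D \<inter> Z = {}" using D emb by blast
  then have card: "card (\<iota> ` D \<union> Z) = d + card Z"
    using Z D D' by (simp add: card_Un_disjoint card_image[OF inj])
  \<comment> \<open>Injectivity of \<open>\<iota>\<close> keeps the failed symbol out of its own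
    helper set.\<close>
  have "\<iota> i \<notin> \<iota> ` D" using emb D i by (auto dest!: inj_onD[of \<iota> "{..<p}"])
  then have sub: "\<iota> ` D \<union> Z \<subseteq> {..<N} - {\<iota> i}" using D emb i by blast
  have "\<iota> i < N" using emb i by blast
  then obtain \<phi> :: "nat \<Rightarrow> 'a vec \<Rightarrow> 'a vec" where
    lin: "\<forall>h\<in>\<iota> ` D \<union> Z. linear_map class_ring (module_vec TYPE('a) \<alpha>) (module_vec TYPE('a) \<beta>) (\<phi> h)"
    and \<phi>: "\<forall>c\<in>C. \<forall>c'\<in>C. (\<forall>h\<in>\<iota> ` D \<union> Z. \<phi> h (symbol \<alpha> c h) = \<phi> h (symbol \<alpha> c' h)) \<longrightarrow>
      symbol \<alpha> c (\<iota> i) = symbol \<alpha> c' (\<iota> i)"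
    using rep[unfolded repairable_from_any_def, rule_format, of "\<iota> i" "\<iota> ` D \<union> Z"] card sub
    by blast
  show "\<exists>\<phi>. (\<forall>h\<in>D. linear_map class_ring (module_vec TYPE('a) \<alpha>) (module_vec TYPE('a) \<beta>) (\<phi> h)) \<and>
      (\<forall>c\<in>L. \<forall>c'\<in>L. (\<forall>h\<in>D. \<phi> h (symbol \<alpha> c h) = \<phi> h (symbol \<alpha> c' h)) \<longrightarrow>
         symbol \<alpha> c i = symbol \<alpha> c' i)"
  proof (intro exI[of _ "\<lambda>h. \<phi> (\<iota> h)"] conjI ballI impI)
    fix x y assume xy: "x \<in> L" "y \<in> L"
      and eq: "\<forall>h\<in>D. \<phi> (\<iota> h) (symbol \<alpha> x h) = \<phi> (\<iota> h) (symbol \<alpha> y h)"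
    from emb xy(1) obtain x' where x': "x' \<in> C" "\<forall>i<p. symbol \<alpha> x' (\<iota> i) = symbol \<alpha> x i"
        "\<forall>z\<in>Z. symbol \<alpha> x' z = 0\<^sub>v \<alpha>" by blast
    from emb xy(2) obtain y' where y': "y' \<in> C" "\<forall>i<p. symbol \<alpha> y' (\<iota> i) = symbol \<alpha> y i"
        "\<forall>z\<in>Z. symbol \<alpha> y' z = 0\<^sub>v \<alpha>" by blast
    have "\<phi> h (symbol \<alpha> x' h) = \<phi> h (symbol \<alpha> y' h)" if "h \<in> \<iota> ` D \<union> Z" for h
      using that
    proof
      assume "h \<in> \<iota> ` D"
      then obtain g where g: "g \<in> D" "g < p" "h = \<iota> g" using D by blast
      then show ?thesis using x'(2) y'(2) eq by simp
    qed (use x'(3) y'(3) in simp)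
    then have "symbol \<alpha> x' (\<iota> i) = symbol \<alpha> y' (\<iota> i)" using \<phi> x'(1) y'(1) by blast
    then show "symbol \<alpha> x i = symbol \<alpha> y i" using x'(2) y'(2) i by simp
  qed (use lin in simp)
qed

section \<open>The construction: outer, local and global codes\<close>

text \<open>\<open>e\<close> stands for \<delta> - 1, the number of local parity symbols, which
  keeps truncated subtraction out of all lengths. The outer code is \<open>C'\<close>.\<close>

locale msr_generator =
  fixes r m e \<Delta> d \<alpha> \<beta> B :: nat and Q Q' :: "'a::{field,finite} mat"
  assumes r: "r \<ge> 1" and m: "m \<ge> 1" and \<alpha>: "\<alpha> > 0"
    and Q: "Q \<in> carrier_mat (m * r * \<alpha>) (e * \<alpha>)"
    and Q': "Q' \<in> carrier_mat (m * r * \<alpha>) (\<Delta> * \<alpha>)"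
    and reg: "regenerating_code (m * r + e + \<Delta>) (m * r) d \<alpha> \<beta> B
      (encode (1\<^sub>m (m * r * \<alpha>) @\<^sub>c Q @\<^sub>c Q') ` carrier_vec (m * r * \<alpha>))"
    and d_less: "d < m * r + e"
begin

abbreviation "outer_gen \<equiv> 1\<^sub>m (m * r * \<alpha>) @\<^sub>c Q @\<^sub>c Q'"
abbreviation "local_gen s \<equiv> 1\<^sub>m (r * \<alpha>) @\<^sub>c row_block (r * \<alpha>) s Q"
abbreviation "global_gen \<equiv> diag_block_mat (map local_gen [0..<m]) @\<^sub>c Q'"
abbreviation "local_code s \<equiv> encode (local_gen s) ` carrier_vec (r * \<alpha>)"
abbreviation "global_code \<equiv> encode global_gen ` carrier_vec (m * r * \<alpha>)"

lemma determined: "determined_by_any (m * r) (m * r + e + \<Delta>) \<alpha> (encode outer_gen ` carrier_vec (m * r * \<alpha>))"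
  using reg by (simp add: regenerating_code_iff)

lemma row_block_Q: "row_block (r * \<alpha>) s Q \<in> carrier_mat (r * \<alpha>) (e * \<alpha>)"
  using row_block_carrier[of "r * \<alpha>" s Q] Q by simp

lemma local_gen_carrier: "local_gen s \<in> carrier_mat (r * \<alpha>) ((r + e) * \<alpha>)"
  using append_cols_carrier[OF one_carrier_mat row_block_Q] by (simp add: add_mult_distrib)

lemma outer_gen_carrier: "outer_gen \<in> carrier_mat (m * r * \<alpha>) ((m * r + e + \<Delta>) * \<alpha>)"
  using append_cols_carrier[OF one_carrier_mat append_cols_carrier[OF Q Q']]
  by (simp add: add_mult_distrib add.assoc)

lemma diag_carrier:
  "diag_block_mat (map local_gen [0..<m]) \<in> carrier_mat (m * r * \<alpha>) (m * (r + e) * \<alpha>)"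
  using diag_block_mat_carrier[of "map local_gen [0..<m]" "r * \<alpha>" "(r + e) * \<alpha>"] local_gen_carrier
  by (auto simp: mult.assoc)

lemma global_gen_carrier: "global_gen \<in> carrier_mat (m * r * \<alpha>) ((m * (r + e) + \<Delta>) * \<alpha>)"
  using append_cols_carrier[OF diag_carrier Q'] by (simp add: add_mult_distrib)

lemma symbol_outer:
  assumes "u \<in> carrier_vec (m * r * \<alpha>)" "i < m * r + e + \<Delta>"
  shows "symbol \<alpha> (encode outer_gen u) i =
    (if i < m * r then symbol \<alpha> u i
     else if i < m * r + e then symbol \<alpha> (encode Q u) (i - m * r)
     else symbol \<alpha> (encode Q' u) (i - m * r - e))"
proof -
  have P: "Q @\<^sub>c Q' \<in> carrier_mat (m * r * \<alpha>) ((e + \<Delta>) * \<alpha>)"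
    using append_cols_carrier[OF Q Q'] by (simp add: add_mult_distrib)
  show ?thesis
    using symbol_systematic[OF P assms(1)] assms(2) encode_carrier[of Q u] encode_carrier[of Q' u] Q Q'
    by (auto simp: encode_append_cols[OF Q Q'] symbol_append[of _ e \<alpha> _ \<Delta>])
qed

lemma symbol_local:
  assumes "v \<in> carrier_vec (r * \<alpha>)" "b < r + e"
  shows "symbol \<alpha> (encode (local_gen s) v) b =
    (if b < r then symbol \<alpha> v b else symbol \<alpha> (encode (row_block (r * \<alpha>) s Q) v) (b - r))"
  using symbol_systematic[OF row_block_Q assms(1,2)] .

lemma symbol_global_diag:
  assumes "t < m" "b < r + e"
  shows "symbol \<alpha> (encode global_gen u) (t * (r + e) + b) =
    symbol \<alpha> (encode (local_gen t) (sub_block (r * \<alpha>) t u)) b"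
proof -
  have lt: "t * (r + e) + b < m * (r + e)" using assms by (rule block_index_less)
  have "symbol \<alpha> (encode global_gen u) (t * (r + e) + b) =
      symbol \<alpha> (encode (diag_block_mat (map local_gen [0..<m])) u) (t * (r + e) + b)"
    unfolding encode_append_cols[OF diag_carrier Q']
    using lt diag_carrier Q' encode_carrier[of "diag_block_mat (map local_gen [0..<m])" u]
      encode_carrier[of Q' u]
    by (subst symbol_append[of _ "m * (r + e)" \<alpha> _ \<Delta>]) auto
  also have "\<dots> = symbol \<alpha> (encode (local_gen t) (sub_block (r * \<alpha>) t u)) b"
    using symbol_diag_block_mat[of "map local_gen [0..<m]" "r * \<alpha>" "r + e" \<alpha> t b u]
      assms local_gen_carrier by auto
  finally show ?thesis .
qed

lemma symbol_global_parity:
  assumes "g < \<Delta>"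
  shows "symbol \<alpha> (encode global_gen u) (m * (r + e) + g) = symbol \<alpha> (encode Q' u) g"
  unfolding encode_append_cols[OF diag_carrier Q']
  using assms diag_carrier Q' encode_carrier[of "diag_block_mat (map local_gen [0..<m])" u]
    encode_carrier[of Q' u]
  by (subst symbol_append[of _ "m * (r + e)" \<alpha> _ \<Delta>]) auto

text \<open>Each local block has \<open>r + e\<close> symbols and begins with its \<open>r\<close>
  message symbols, so message symbol \<open>i\<close> sits in block \<open>i div r\<close> at offset
  \<open>i mod r\<close>. Reading these positions recovers the message, which makes the global
  encoding injective.\<close>

lemma symbol_global_message:
  assumes "i < m * r"
  shows "symbol \<alpha> (encode global_gen u) (i div r * (r + e) + i mod r) = symbol \<alpha> u i"
proof -
  have "i div r < m" "i mod r < r" using assms r by (auto simp: div_less_iff_less_mult)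
  then show ?thesis
    using symbol_global_diag[of "i div r" "i mod r" u]
    by (simp add: symbol_local sub_block_carrier symbol_sub_block)
qed

lemma inj_encode_global: "inj_on (encode global_gen) (carrier_vec (m * r * \<alpha>))"
proof (rule inj_onI)
  fix u v assume "u \<in> carrier_vec (m * r * \<alpha>)" "v \<in> carrier_vec (m * r * \<alpha>)"
    "encode global_gen u = encode global_gen v"
  then show "u = v"
    using symbol_global_message by (intro vec_eq_if_symbols_eq[of u "m * r" \<alpha>]) metis+
qed

lemma inj_encode_outer: "inj_on (encode outer_gen) (carrier_vec (m * r * \<alpha>))"
  using append_cols_carrier[OF Q Q'] by (rule inj_encode_systematic)

lemma inj_encode_local: "inj_on (encode (local_gen s)) (carrier_vec (r * \<alpha>))"
  using row_block_Q by (rule inj_encode_systematic)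

section \<open>The local codes are MSR codes\<close>

text \<open>The retained positions are message block \<open>s\<close> and the \<open>e\<close>
  parities from \<open>Q\<close>; the other message symbols are fixed to zero. The \<Delta> symbols
  from \<open>Q'\<close> are punctured.\<close>

lemma local_code_embeds:
  assumes s: "s < m"
  shows "embeds_as_shortening \<alpha> (r + e) (m * r + e + \<Delta>)
    (\<lambda>b. if b < r then s * r + b else m * r + (b - r)) ({..<m * r} - {s * r..<s * r + r})
    (local_code s) (encode outer_gen ` carrier_vec (m * r * \<alpha>))"
  unfolding embeds_as_shortening_def
proof (intro conjI ballI)
  \<comment> \<open>Message positions stay below \<open>m * r\<close> and so cannot collide with
    parity positions.\<close>
  have lt: "s * r + b < m * r" if "b < r" for b using block_index_less[OF s that] .
  show "inj_on (\<lambda>b. if b < r then s * r + b else m * r + (b - r)) {..<r + e}"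
    using lt by (intro inj_onI) (auto split: if_splits; fastforce)
  show "(\<lambda>b. if b < r then s * r + b else m * r + (b - r)) ` {..<r + e} \<subseteq> {..<m * r + e + \<Delta>}"
    using lt by (fastforce split: if_splits)
  show "{..<m * r} - {s * r..<s * r + r} \<subseteq>
      {..<m * r + e + \<Delta>} - (\<lambda>b. if b < r then s * r + b else m * r + (b - r)) ` {..<r + e}"
    by (auto split: if_splits)
next
  fix c assume "c \<in> local_code s"
  then obtain v where v: "v \<in> carrier_vec (r * \<alpha>)" "c = encode (local_gen s) v" by auto
  define u where "u = inject_block m (r * \<alpha>) s v"
  have u: "u \<in> carrier_vec (m * r * \<alpha>)"
    using inject_block_carrier[of m "r * \<alpha>" s v] by (simp add: u_def mult.assoc)
  have sub: "sub_block (r * \<alpha>) t u = (if t = s then v else 0\<^sub>v (r * \<alpha>))" if "t < m" for t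
    unfolding u_def using that v(1) by (rule sub_block_inject)
  have Qu: "encode Q u = encode (row_block (r * \<alpha>) s Q) v"
    unfolding u_def using Q s v by (intro encode_inject_block) (auto simp: mult.assoc)
  have "symbol \<alpha> (encode outer_gen u) (if b < r then s * r + b else m * r + (b - r)) = symbol \<alpha> c b"
    if b: "b < r + e" for b
    using b u v block_index_less[OF s, of b r] sub[OF s] symbol_sub_block[of b r \<alpha> s u]
    by (auto simp: symbol_outer symbol_local Qu)
  moreover have "symbol \<alpha> (encode outer_gen u) z = 0\<^sub>v \<alpha>"
    if z: "z \<in> {..<m * r} - {s * r..<s * r + r}" for z
  proof -
    have zr: "z div r < m" "z mod r < r" using z r by (auto simp: div_less_iff_less_mult)
    have "z div r \<noteq> s"
    proof
      assume "z div r = s"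
      then have "z = s * r + z mod r" by (metis div_mult_mod_eq)
      with z zr show False by (metis DiffE add_less_cancel_left atLeastLessThan_iff le_add1)
    qed
    then have "symbol \<alpha> u z = symbol \<alpha> (0\<^sub>v (r * \<alpha>)) (z mod r)"
      using symbol_sub_block[OF zr(2), of \<alpha> "z div r" u] sub[OF zr(1)] by simp
    then show ?thesis using z u zr by (simp add: symbol_outer symbol_zero)
  qed
  ultimately show "\<exists>c'\<in>encode outer_gen ` carrier_vec (m * r * \<alpha>).
      (\<forall>i<r + e. symbol \<alpha> c' (if i < r then s * r + i else m * r + (i - r)) = symbol \<alpha> c i) \<and>
      (\<forall>z\<in>{..<m * r} - {s * r..<s * r + r}. symbol \<alpha> c' z = 0\<^sub>v \<alpha>)"
    using u by blast
qed

lemma card_other_messages: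
  assumes "s < m"
  shows "card ({..<m * r} - {s * r..<s * r + r}) = (m - 1) * r"
proof -
  have "Suc s * r \<le> m * r" using assms by (intro mult_le_mono1) simp
  then have "{s * r..<s * r + r} \<subseteq> {..<m * r}" by auto
  then show ?thesis by (simp add: card_Diff_subset diff_mult_distrib)
qed

lemma message_split: "r + (m - 1) * r = m * r"
  using m by (cases m) auto

lemma local_code_carrier: "local_code s \<subseteq> carrier_vec ((r + e) * \<alpha>)"
  using encode_carrier[of "local_gen s"] local_gen_carrier[of s] by auto

lemma local_code_determined:
  assumes "s < m"
  shows "determined_by_any r (r + e) \<alpha> (local_code s)"
  using shortening_determined_by_any[OF local_code_embeds[OF assms] local_code_carrier, of r]
    determined card_other_messages[OF assms] message_split by simp

lemma local_code_row_space: "vec_space.row_space ((r + e) * \<alpha>) (local_gen s) = local_code s"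
  using row_space_eq_encode[of "local_gen s" "(r + e) * \<alpha>"] local_gen_carrier[of s] by auto

lemma local_symbol_surjective:
  assumes "s < m" "i < r + e" "x \<in> carrier_vec \<alpha>"
  shows "\<exists>v\<in>carrier_vec (r * \<alpha>). symbol \<alpha> (encode (local_gen s) v) i = x"
  using symbol_surjective[OF _ inj_encode_local local_code_determined] local_gen_carrier[of s] r assms
  by auto

text \<open>For d_L = d - (m - 1) r the difference d_L - r equals d - m r, so the MSR relation holds
  with the same \<alpha> and \<beta>. The bounds r \<le> d_L < r + e translate m r \<le> d < m r +
  e.\<close>

lemma local_code_msr:
  assumes s: "s < m" and \<alpha>_eq: "\<alpha> = (d - m * r + 1) * \<beta>"
  shows "msr_code (r + e) r (d - (m - 1) * r) \<alpha> \<beta> (local_code s)"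
proof -
  note split = message_split
  have d: "m * r \<le> d" using reg by (simp add: regenerating_code_iff)
  have "repairable_from_any (d - (m - 1) * r) (r + e) \<alpha> \<beta> (local_code s)"
    using shortening_repairable_from_any[OF local_code_embeds[OF s], of "d - (m - 1) * r"] reg
      card_other_messages[OF s] split d
    by (simp add: regenerating_code_iff)
  moreover have "vector_code (r + e) \<alpha> (local_code s)"
  proof (rule vector_code_if_symbols_surjective[OF \<alpha>])
    show "VectorSpace.subspace class_ring (local_code s) (module_vec TYPE('a) ((r + e) * \<alpha>))"
      using subspace_row_space[of "local_gen s" "(r + e) * \<alpha>"] local_gen_carrier[of s]
      by (auto simp: local_code_row_space)
  qed (use local_symbol_surjective[OF s] in blast)
  moreover have "scalar_dim (r + e) \<alpha> (local_code s) = r * \<alpha>"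
    using generator_matrix_row_space(2)[of "local_gen s" "r + e" \<alpha>] local_gen_carrier[of s]
      inj_encode_local[of s] by (auto simp: local_code_row_space)
  moreover have "d - (m - 1) * r - r = d - m * r" using split by simp
  moreover have "r \<le> d - (m - 1) * r" "d - (m - 1) * r < r + e" using split d d_less by auto
  ultimately show ?thesis
    using \<alpha>_eq local_code_determined[OF s] by (simp add: msr_code_def regenerating_code_iff)
qed

section \<open>The global code: restrictions, standing assumption, rank\<close>

text \<open>The restriction sees only message block \<open>s\<close>, and every vector occurs as
  that block of some message, so the whole local code is obtained and not merely a subcode.\<close>

lemma restrict_global_code:
  assumes s: "s < m"
  shows "restrict_code \<alpha> {s * (r + e)..<s * (r + e) + (r + e)} global_code = local_code s"
proof -
  have "vec ((r + e) * \<alpha>) (\<lambda>j. encode global_gen u $ (s * (r + e) * \<alpha> + j)) =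
      encode (local_gen s) (sub_block (r * \<alpha>) s u)" for u
  proof (rule vec_eq_if_symbols_eq[of _ "r + e" \<alpha>])
    show "encode (local_gen s) (sub_block (r * \<alpha>) s u) \<in> carrier_vec ((r + e) * \<alpha>)"
      using encode_carrier[of "local_gen s"] local_gen_carrier[of s] by auto
    fix b assume b: "b < r + e"
    have "symbol \<alpha> (vec ((r + e) * \<alpha>) (\<lambda>j. encode global_gen u $ (s * (r + e) * \<alpha> + j))) b =
        symbol \<alpha> (encode global_gen u) (s * (r + e) + b)"
      using block_index_less[OF b, of _ \<alpha>]
      by (intro eq_vecI) (auto simp: symbol_def add_mult_distrib add.assoc)
    then show "symbol \<alpha> (vec ((r + e) * \<alpha>) (\<lambda>j. encode global_gen u $ (s * (r + e) * \<alpha> + j))) b =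
        symbol \<alpha> (encode (local_gen s) (sub_block (r * \<alpha>) s u)) b"
      using symbol_global_diag[OF s b] by simp
  qed simp
  then have "restrict_code \<alpha> {s * (r + e)..<s * (r + e) + (r + e)} global_code =
      encode (local_gen s) ` sub_block (r * \<alpha>) s ` carrier_vec (m * r * \<alpha>)"
    by (simp add: restrict_code_interval[OF \<alpha>] image_image)
  moreover have "sub_block (r * \<alpha>) s ` carrier_vec (m * r * \<alpha>) = (carrier_vec (r * \<alpha>) :: 'a vec set)"
  proof
    show "(carrier_vec (r * \<alpha>) :: 'a vec set) \<subseteq> sub_block (r * \<alpha>) s ` carrier_vec (m * r * \<alpha>)"
    proof
      fix v :: "'a vec" assume "v \<in> carrier_vec (r * \<alpha>)"
      then have "v = sub_block (r * \<alpha>) s (inject_block m (r * \<alpha>) s v)"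
        using sub_block_inject[OF s, of v "r * \<alpha>" s] by simp
      moreover have "inject_block m (r * \<alpha>) s v \<in> carrier_vec (m * r * \<alpha>)"
        using inject_block_carrier[of m "r * \<alpha>" s v] by (simp add: mult.assoc)
      ultimately show "v \<in> sub_block (r * \<alpha>) s ` carrier_vec (m * r * \<alpha>)" by (rule image_eqI)
    qed
  qed (auto simp: sub_block_carrier)
  ultimately show ?thesis by simp
qed

lemma global_code_row_space:
  "vec_space.row_space ((m * (r + e) + \<Delta>) * \<alpha>) global_gen = global_code"
  using row_space_eq_encode[of global_gen "(m * (r + e) + \<Delta>) * \<alpha>"] global_gen_carrier by auto

text \<open>Symbols in the diagonal part inherit surjectivity from a local code. The last \<Delta>
  symbols are those of the outer codeword with the same message and inherit it from the outer
  code.\<close>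

lemma global_symbol_surjective:
  assumes i: "i < m * (r + e) + \<Delta>" and x: "x \<in> carrier_vec \<alpha>"
  shows "\<exists>u\<in>carrier_vec (m * r * \<alpha>). symbol \<alpha> (encode global_gen u) i = x"
proof (cases "i < m * (r + e)")
  case True
  define s b where "s = i div (r + e)" and "b = i mod (r + e)"
  have i_eq: "i = s * (r + e) + b" by (simp only: s_def b_def div_mult_mod_eq)
  have s: "s < m" and b: "b < r + e" using True r by (auto simp: s_def b_def div_less_iff_less_mult)
  obtain v where v: "v \<in> carrier_vec (r * \<alpha>)" "symbol \<alpha> (encode (local_gen s) v) b = x"
    using local_symbol_surjective[OF s b x] by auto
  have "symbol \<alpha> (encode global_gen (inject_block m (r * \<alpha>) s v)) i = x"
    using v s b by (simp add: i_eq symbol_global_diag sub_block_inject)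
  then show ?thesis using inject_block_carrier[of m "r * \<alpha>" s v] by (auto simp: mult.assoc)
next
  case False
  define g where "g = i - m * (r + e)"
  have g: "g < \<Delta>" "i = m * (r + e) + g" using False i by (auto simp: g_def)
  have "\<exists>u\<in>carrier_vec (m * r * \<alpha>). symbol \<alpha> (encode outer_gen u) (m * r + e + g) = x"
    using symbol_surjective[OF _ inj_encode_outer determined, of "m * r + e + g" x] outer_gen_carrier
      r m g x by auto
  then show ?thesis using g by (auto simp: symbol_outer symbol_global_parity)
qed

lemma global_vector_code: "vector_code (m * (r + e) + \<Delta>) \<alpha> global_code"
proof (rule vector_code_if_symbols_surjective[OF \<alpha>])
  show "VectorSpace.subspace class_ring global_code (module_vec TYPE('a) ((m * (r + e) + \<Delta>) * \<alpha>))"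
    using subspace_row_space[of global_gen "(m * (r + e) + \<Delta>) * \<alpha>"] global_gen_carrier
    by (auto simp: global_code_row_space)
qed (use global_symbol_surjective in blast)

text \<open>Each diagonal block contains an identity matrix, so all unit vectors occur among the
  columns of the diagonal part.\<close>

lemma rank_local_supports:
  "vec_space.rank (m * r * \<alpha>) (restrict_mat \<alpha> {0..<m * (r + e)} global_gen) = m * r * \<alpha>"
proof (rule rank_eq_if_unit_vecs)
  let ?R = "restrict_mat \<alpha> {0..<m * (r + e)} global_gen"
  have le: "m * (r + e) * \<alpha> \<le> dim_col global_gen"
    using global_gen_carrier by (auto simp: add_mult_distrib)
  have R: "?R = mat (m * r * \<alpha>) (m * (r + e) * \<alpha>) (\<lambda>(i, j). global_gen $$ (i, j))"
    using restrict_mat_interval[OF \<alpha> le, of 0] global_gen_carrier by auto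
  then show "dim_row ?R = m * r * \<alpha>" by simp
  show "set (unit_vecs (m * r * \<alpha>)) \<subseteq> set (cols ?R)"
  proof
    fix v assume "v \<in> set (unit_vecs (m * r * \<alpha>) :: 'a vec list)"
    then obtain k where k: "k < m * r * \<alpha>" "v = unit_vec (m * r * \<alpha>) k"
      by (auto simp: unit_vecs_def)
    define s a where "s = k div (r * \<alpha>)" and "a = k mod (r * \<alpha>)"
    have k_eq: "k = s * (r * \<alpha>) + a" by (simp only: s_def a_def div_mult_mod_eq)
    have s: "s < m" and a: "a < r * \<alpha>"
      using k r \<alpha> by (auto simp: s_def a_def div_less_iff_less_mult mult.assoc)
    have a': "a < (r + e) * \<alpha>" using a by (simp add: add_mult_distrib)
    \<comment> \<open>Block widths include the parities while block heights do not: row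
      \<open>k\<close> has offset \<open>a\<close> in a block of height \<open>r * \<alpha>\<close>,
      and its unit column has the same offset in a block of width
      \<open>(r + e) * \<alpha>\<close>.\<close>
    let ?j = "s * ((r + e) * \<alpha>) + a"
    have j: "?j < m * (r + e) * \<alpha>" using block_index_less[OF s a'] by (simp add: mult.assoc)
    have "col ?R ?j = v"
    proof (rule eq_vecI)
      fix i assume "i < dim_vec v"
      then have i: "i < m * r * \<alpha>" using k by simp
      define t c where "t = i div (r * \<alpha>)" and "c = i mod (r * \<alpha>)"
      have i_eq: "i = t * (r * \<alpha>) + c" by (simp only: t_def c_def div_mult_mod_eq)
      have t: "t < m" and c: "c < r * \<alpha>"
        using i r \<alpha> by (auto simp: t_def c_def div_less_iff_less_mult mult.assoc)
      have "global_gen $$ (i, ?j) = diag_block_mat (map local_gen [0..<m]) $$ (i, ?j)"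
        using diag_carrier Q' i j by (auto simp: append_cols_def)
      also have "\<dots> = (if t = s then (map local_gen [0..<m] ! t) $$ (c, a) else 0)"
        unfolding i_eq by (intro diag_block_mat_index) (use t s c a' local_gen_carrier in auto)
      also have "\<dots> = (if t = s \<and> c = a then 1 else 0)"
        using t c a row_block_Q[of t] by (auto simp: append_cols_def)
      also have "(t = s \<and> c = a) = (i = k)"
        by (auto simp: s_def t_def a_def c_def) (metis div_mult_mod_eq)
      finally show "col ?R ?j $ i = v $ i" using i j k by (simp add: R)
    qed (simp add: R k)
    moreover have "?j < length (cols ?R)" using j by (simp add: R)
    ultimately show "v \<in> set (cols ?R)" by (metis cols_length cols_nth nth_mem)
  qed
qed

section \<open>Minimum distances\<close>

text \<open>Any \<open>r\<close> of the \<open>r + e\<close> local symbols determine the word, so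
  the MDS bound gives \<open>e + 1\<close>, which is \<delta>. The first unit vector shows that the
  code is nonzero.\<close>

lemma local_min_dist:
  assumes s: "s < m"
  shows "e + 1 \<le> min_dist (r + e) \<alpha> (local_code s)"
proof -
  let ?N = "(r + e) * \<alpha>"
  have zero: "encode (local_gen s) (0\<^sub>v (r * \<alpha>)) = 0\<^sub>v ?N"
    using encode_zero[of "local_gen s"] local_gen_carrier[of s] by auto
  have "unit_vec (r * \<alpha>) 0 \<noteq> (0\<^sub>v (r * \<alpha>) :: 'a vec)"
    using r \<alpha> by (intro unit_vec_nonzero) auto
  then have "encode (local_gen s) (unit_vec (r * \<alpha>) 0) \<noteq> 0\<^sub>v ?N"
    using inj_onD[OF inj_encode_local[of s], of "unit_vec (r * \<alpha>) 0" "0\<^sub>v (r * \<alpha>)"] zero by auto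
  moreover have "encode (local_gen s) (unit_vec (r * \<alpha>) 0) \<in> local_code s" by simp
  moreover have "0\<^sub>v ?N \<in> local_code s" using zero by (metis imageI zero_carrier_vec)
  ultimately show ?thesis
    using hamming_weight_ge_if_determined[OF local_code_determined[OF s]]
    by (intro min_dist_geI[of "encode (local_gen s) (unit_vec (r * \<alpha>) 0)"]) auto
qed

text \<open>Adding up the copies of each parity symbol folds a global codeword onto an outer one, so the
  outer codeword is nonzero only at images of nonzero positions.\<close>

lemma outer_weight_le_global_weight:
  assumes u: "u \<in> carrier_vec (m * r * \<alpha>)"
  shows "hamming_weight (m * r + e + \<Delta>) \<alpha> (encode outer_gen u) \<le>
    hamming_weight (m * (r + e) + \<Delta>) \<alpha> (encode global_gen u)"
proof -
  \<comment> \<open>\<open>\<pi>\<close> renumbers message symbols and global parities, and sends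
    the copy of parity \<open>p\<close> in any local block to parity \<open>p\<close> of the outer
    code.\<close>
  define \<pi> where "\<pi> x =
    (if x < m * (r + e) then
       if x mod (r + e) < r then x div (r + e) * r + x mod (r + e) else m * r + (x mod (r + e) - r)
     else x - m * (r + e) + m * r + e)" for x
  let ?W = "{x. x < m * (r + e) + \<Delta> \<and> symbol \<alpha> (encode global_gen u) x \<noteq> 0\<^sub>v \<alpha>}"
  have \<pi>_diag: "\<pi> (t * (r + e) + b) = (if b < r then t * r + b else m * r + (b - r))"
    if "t < m" "b < r + e" for t b
    using that block_index_less[OF that] by (simp add: \<pi>_def)
  have "{y. y < m * r + e + \<Delta> \<and> symbol \<alpha> (encode outer_gen u) y \<noteq> 0\<^sub>v \<alpha>} \<subseteq> \<pi> ` ?W"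
  proof safe
    fix y assume y: "y < m * r + e + \<Delta>" and nz: "symbol \<alpha> (encode outer_gen u) y \<noteq> 0\<^sub>v \<alpha>"
    consider "y < m * r" | p where "p < e" "y = m * r + p" | g where "g < \<Delta>" "y = m * r + e + g"
      using y by (metis add.assoc add_less_cancel_left le_add_diff_inverse not_less)
    then show "y \<in> \<pi> ` ?W"
    proof cases
      case 1
      let ?x = "y div r * (r + e) + y mod r"
      have y': "y div r < m" "y mod r < r" using 1 r by (auto simp: div_less_iff_less_mult)
      then have "?x < m * (r + e)" by (intro block_index_less) auto
      moreover have "symbol \<alpha> (encode global_gen u) ?x \<noteq> 0\<^sub>v \<alpha>"
        using nz 1 u by (simp add: symbol_global_message symbol_outer)
      moreover have "\<pi> ?x = y" using \<pi>_diag[of "y div r" "y mod r"] y' by simp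
      ultimately show ?thesis by (intro image_eqI[of y \<pi> ?x]) auto
    next
      case 2
      have "\<exists>t<m. symbol \<alpha> (encode (row_block (r * \<alpha>) t Q) (sub_block (r * \<alpha>) t u)) p \<noteq> 0\<^sub>v \<alpha>"
      proof (rule ccontr)
        assume "\<not> ?thesis"
        then have z: "symbol \<alpha> (encode (row_block (r * \<alpha>) t Q) (sub_block (r * \<alpha>) t u)) p = 0\<^sub>v \<alpha>"
          if "t < m" for t using that by blast
        have "symbol \<alpha> (encode Q u) p = 0\<^sub>v \<alpha>"
        proof (rule eq_vecI)
          fix j assume "j < dim_vec (0\<^sub>v \<alpha>)"
          then have j: "j < \<alpha>" by simp
          have "encode (row_block (r * \<alpha>) t Q) (sub_block (r * \<alpha>) t u) $ (p * \<alpha> + j) = 0"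
            if "t < m" for t
            using arg_cong[OF z[OF that], of "\<lambda>v. v $ j"] j by (simp add: symbol_def)
          then have "encode Q u $ (p * \<alpha> + j) = 0"
            using encode_row_blocks[of Q m "r * \<alpha>" "p * \<alpha> + j" u] Q block_index_less[OF 2(1) j]
            by (auto simp: mult.assoc)
          then show "symbol \<alpha> (encode Q u) p $ j = 0\<^sub>v \<alpha> $ j" using j by (simp add: symbol_def)
        qed (simp add: symbol_def)
        then show False using nz u 2 by (simp add: symbol_outer)
      qed
      then obtain t where t: "t < m"
        "symbol \<alpha> (encode (row_block (r * \<alpha>) t Q) (sub_block (r * \<alpha>) t u)) p \<noteq> 0\<^sub>v \<alpha>" by blast
      let ?x = "t * (r + e) + (r + p)"
      have "?x < m * (r + e)" using t 2 by (intro block_index_less) auto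
      moreover have "symbol \<alpha> (encode global_gen u) ?x \<noteq> 0\<^sub>v \<alpha>"
        using t 2 symbol_global_diag[of t "r + p" u] by (simp add: symbol_local sub_block_carrier)
      moreover have "\<pi> ?x = y" using \<pi>_diag[of t "r + p"] t 2 by simp
      ultimately show ?thesis by (intro image_eqI[of y \<pi> ?x]) auto
    next
      case 3
      let ?x = "m * (r + e) + g"
      have "symbol \<alpha> (encode global_gen u) ?x \<noteq> 0\<^sub>v \<alpha>"
        using nz 3 u by (simp add: symbol_outer symbol_global_parity)
      then show ?thesis using 3 by (intro image_eqI[of y \<pi> ?x]) (auto simp: \<pi>_def)
    qed
  qed
  \<comment> \<open>Several copies of one parity may be nonzero over a single outer symbol, so
    \<open>\<pi>\<close> only bounds the outer weight from above.\<close>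
  then have "card {y. y < m * r + e + \<Delta> \<and> symbol \<alpha> (encode outer_gen u) y \<noteq> 0\<^sub>v \<alpha>} \<le> card ?W"
    by (intro surj_card_le) auto
  then show ?thesis by (simp add: hamming_weight_def)
qed

text \<open>Only message symbol 0 is nonzero, so all local blocks but block 0 encode zero. What can
  remain is that symbol, the \<open>e\<close> parities of block 0 and the \<Delta> global parities,
  which form \<open>?W\<close>.\<close>

lemma global_weight_unit_vec:
  "hamming_weight (m * (r + e) + \<Delta>) \<alpha> (encode global_gen (unit_vec (m * r * \<alpha>) 0)) \<le> e + \<Delta> + 1"
proof -
  let ?u = "unit_vec (m * r * \<alpha>) 0 :: 'a vec"
  let ?W = "insert 0 ({r..<r + e} \<union> {m * (r + e)..<m * (r + e) + \<Delta>})"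
  have msg: "symbol \<alpha> ?u i = 0\<^sub>v \<alpha>" if i: "0 < i" "i < m * r" for i
    using block_index_less[OF i(2), of _ \<alpha>] i(1) r m \<alpha>
    by (intro eq_vecI) (auto simp: symbol_def)
  have "{x. x < m * (r + e) + \<Delta> \<and> symbol \<alpha> (encode global_gen ?u) x \<noteq> 0\<^sub>v \<alpha>} \<subseteq> ?W"
  proof (intro subsetI, rule ccontr)
    fix x assume "x \<in> {x. x < m * (r + e) + \<Delta> \<and> symbol \<alpha> (encode global_gen ?u) x \<noteq> 0\<^sub>v \<alpha>}"
      and nW: "x \<notin> ?W"
    then have x: "x < m * (r + e) + \<Delta>" "symbol \<alpha> (encode global_gen ?u) x \<noteq> 0\<^sub>v \<alpha>" by auto
    define s b where "s = x div (r + e)" and "b = x mod (r + e)"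
    have x_eq: "x = s * (r + e) + b" by (simp only: s_def b_def div_mult_mod_eq)
    have s: "s < m" and b: "b < r + e" using x(1) nW r by (auto simp: s_def b_def div_less_iff_less_mult)
    have "symbol \<alpha> (encode global_gen ?u) x = 0\<^sub>v \<alpha>"
    proof (cases "s = 0")
      case True
      then have "0 < x" "x < r" using nW b x_eq by auto
      moreover have "x < m * r" using \<open>x < r\<close> by (rule less_le_trans) (use m in simp)
      ultimately show ?thesis
        using symbol_global_diag[of 0 x ?u] m \<open>0 < x\<close> \<open>x < r\<close> msg
        by (simp add: symbol_local sub_block_carrier symbol_sub_block)
    next
      case False
      have "sub_block (r * \<alpha>) s ?u = 0\<^sub>v (r * \<alpha>)"
      proof (rule eq_vecI)
        fix a assume "a < dim_vec (0\<^sub>v (r * \<alpha>))"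
        then have a: "a < r * \<alpha>" by simp
        then have "s * (r * \<alpha>) + a < m * r * \<alpha>" "s * (r * \<alpha>) + a \<noteq> 0"
          using block_index_less[OF s a] False r \<alpha> by (auto simp: mult.assoc)
        then show "sub_block (r * \<alpha>) s ?u $ a = 0\<^sub>v (r * \<alpha>) $ a" using a r m \<alpha> by (simp add: sub_block_def)
      qed (simp add: sub_block_def)
      moreover have "encode (local_gen s) (0\<^sub>v (r * \<alpha>)) = 0\<^sub>v ((r + e) * \<alpha>)"
        using encode_zero[of "local_gen s"] local_gen_carrier[of s] by auto
      ultimately show ?thesis
        unfolding x_eq symbol_global_diag[OF s b] using b by (simp add: symbol_zero)
    qed
    with x(2) show False by simp
  qed
  then have "card {x. x < m * (r + e) + \<Delta> \<and> symbol \<alpha> (encode global_gen ?u) x \<noteq> 0\<^sub>v \<alpha>} \<le> card ?W"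
    by (intro card_mono) auto
  also have "card ?W \<le> Suc (card ({r..<r + e} \<union> {m * (r + e)..<m * (r + e) + \<Delta>}))"
    by (rule card_insert_le_m1) auto
  also have "\<dots> \<le> Suc (e + \<Delta>)"
    using card_Un_le[of "{r..<r + e}" "{m * (r + e)..<m * (r + e) + \<Delta>}"] by simp
  finally show ?thesis by (simp add: hamming_weight_def)
qed

lemma global_min_dist: "min_dist (m * (r + e) + \<Delta>) \<alpha> global_code = e + \<Delta> + 1"
proof (rule min_dist_eqI)
  let ?u = "unit_vec (m * r * \<alpha>) 0 :: 'a vec"
  have zero_global: "encode global_gen (0\<^sub>v (m * r * \<alpha>)) = 0\<^sub>v ((m * (r + e) + \<Delta>) * \<alpha>)"
    using encode_zero[of global_gen] global_gen_carrier by auto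
  have zero_outer: "encode outer_gen (0\<^sub>v (m * r * \<alpha>)) = 0\<^sub>v ((m * r + e + \<Delta>) * \<alpha>)"
    using encode_zero[of outer_gen] outer_gen_carrier by auto
  show "encode global_gen ?u \<in> global_code" by simp
  have "?u \<noteq> 0\<^sub>v (m * r * \<alpha>)" using r m \<alpha> by (intro unit_vec_nonzero) auto
  then show "encode global_gen ?u \<noteq> 0\<^sub>v ((m * (r + e) + \<Delta>) * \<alpha>)"
    using inj_onD[OF inj_encode_global, of ?u "0\<^sub>v (m * r * \<alpha>)"] zero_global by auto
  show "hamming_weight (m * (r + e) + \<Delta>) \<alpha> (encode global_gen ?u) \<le> e + \<Delta> + 1"
    by (rule global_weight_unit_vec)
  fix c assume "c \<in> global_code" and nz: "c \<noteq> 0\<^sub>v ((m * (r + e) + \<Delta>) * \<alpha>)"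
  then obtain u where u: "u \<in> carrier_vec (m * r * \<alpha>)" and c: "c = encode global_gen u" by auto
  have "u \<noteq> 0\<^sub>v (m * r * \<alpha>)" using nz zero_global c by auto
  then have "encode outer_gen u \<noteq> 0\<^sub>v ((m * r + e + \<Delta>) * \<alpha>)"
    using inj_onD[OF inj_encode_outer _ u, of "0\<^sub>v (m * r * \<alpha>)"] zero_outer by auto
  moreover have "0\<^sub>v ((m * r + e + \<Delta>) * \<alpha>) \<in> encode outer_gen ` carrier_vec (m * r * \<alpha>)"
    using zero_outer by (metis imageI zero_carrier_vec)
  ultimately have "e + \<Delta> + 1 \<le> hamming_weight (m * r + e + \<Delta>) \<alpha> (encode outer_gen u)"
    using hamming_weight_ge_if_determined[OF determined, of "encode outer_gen u"] u by simp
  then show "e + \<Delta> + 1 \<le> hamming_weight (m * (r + e) + \<Delta>) \<alpha> c"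
    using outer_weight_le_global_weight[OF u] c by simp
qed

section \<open>Locality of the global code and the stated parameters\<close>

lemma generator_matrix_global:
  "generator_matrix (m * (r + e) + \<Delta>) \<alpha> global_gen global_code"
  "scalar_dim (m * (r + e) + \<Delta>) \<alpha> global_code = m * r * \<alpha>"
  using generator_matrix_row_space[of global_gen "m * (r + e) + \<Delta>" \<alpha>] global_gen_carrier
    inj_encode_global by (auto simp: global_code_row_space)

text \<open>The supports are \<open>m\<close> consecutive intervals of length \<open>r + e\<close>.
  They tile everything except the \<Delta> global parities, so their union is the diagonal part,
  whose rank is known to be full.\<close>

lemma global_local_supports:
  "local_supports (m * (r + e) + \<Delta>) \<alpha> r (e + 1) global_code {..<m}
    (\<lambda>s. {s * (r + e)..<s * (r + e) + (r + e)})"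
proof -
  have sub: "{s * (r + e)..<s * (r + e) + (r + e)} \<subseteq> {0..<m * (r + e)}" if "s < m" for s
  proof -
    have "Suc s * (r + e) \<le> m * (r + e)" using that by (intro mult_le_mono1) simp
    then show ?thesis by auto
  qed
  have "x \<in> (\<Union>s<m. {s * (r + e)..<s * (r + e) + (r + e)})" if "x < m * (r + e)" for x
  proof
    show "x div (r + e) \<in> {..<m}" using that r by (simp add: div_less_iff_less_mult)
    have "x mod (r + e) < r + e" using r by simp
    then show "x \<in> {x div (r + e) * (r + e)..<x div (r + e) * (r + e) + (r + e)}"
      using div_mult_mod_eq[of x "r + e"] by (metis add_less_cancel_left atLeastLessThan_iff le_add1)
  qed
  then have union: "(\<Union>s<m. {s * (r + e)..<s * (r + e) + (r + e)}) = {0..<m * (r + e)}"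
    using sub by fastforce
  have "dim_row global_gen = m * r * \<alpha>" using global_gen_carrier by auto
  then have "generator_matrix (m * (r + e) + \<Delta>) \<alpha> global_gen global_code \<and>
      vec_space.rank (dim_row global_gen)
        (restrict_mat \<alpha> (\<Union>s\<in>{..<m}. {s * (r + e)..<s * (r + e) + (r + e)}) global_gen) =
      scalar_dim (m * (r + e) + \<Delta>) \<alpha> global_code"
    using generator_matrix_global rank_local_supports unfolding union by simp
  moreover have "{s * (r + e)..<s * (r + e) + (r + e)} \<subseteq> {..<m * (r + e) + \<Delta>}" if "s < m" for s
    using sub[OF that] by auto
  ultimately show ?thesis
    unfolding local_supports_def using restrict_global_code local_min_dist by auto
qed

lemma global_msr_local_code:
  assumes "\<alpha> = (d - m * r + 1) * \<beta>"
  shows "msr_local_code (m * (r + e) + \<Delta>) m r (e + 1) \<alpha> \<beta> global_code"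
  unfolding msr_local_code_def information_locality_def
  using global_vector_code global_local_supports local_code_msr[OF _ assms] restrict_global_code
  by (auto intro!: exI[of _ "d - (m - 1) * r"] exI[of _ "\<lambda>s. {s * (r + e)..<s * (r + e) + (r + e)}"])

end

theorem mainTheorem9:
  fixes r m \<delta> \<Delta> d \<alpha> \<beta> n K :: nat
    and C C' :: "'a::{field,finite} vec set"
    and Q Q' G :: "'a mat"
  assumes "r \<ge> 1" and "m \<ge> 1" and "\<delta> \<ge> 3"
    and "msr_code (m * r + \<delta> - 1 + \<Delta>) (m * r) d \<alpha> \<beta> C'"
    and "d \<le> m * r + \<delta> - 2"
    and "Q \<in> carrier_mat (m * r * \<alpha>) ((\<delta> - 1) * \<alpha>)"
    and "Q' \<in> carrier_mat (m * r * \<alpha>) (\<Delta> * \<alpha>)"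
    and "generator_matrix (m * r + \<delta> - 1 + \<Delta>) \<alpha> (1\<^sub>m (m * r * \<alpha>) @\<^sub>c Q @\<^sub>c Q') C'"
    and "G = diag_block_mat (map (\<lambda>i. 1\<^sub>m (r * \<alpha>) @\<^sub>c row_block (r * \<alpha>) i Q) [0..<m]) @\<^sub>c Q'"
    and "dim_col G = n * \<alpha>"
    and "C = vec_space.row_space (n * \<alpha>) G"
    and "K = scalar_dim n \<alpha> C"
  shows "generator_matrix n \<alpha> G C
    \<and> msr_local_code n m r \<delta> \<alpha> \<beta> C
    \<and> K = m * r * \<alpha>
    \<and> n = m * (r + \<delta> - 1) + \<Delta>
    \<and> int \<alpha> = (int d - int (m * r) + 1) * int \<beta>
    \<and> real (min_dist n \<alpha> C) =
        real n - real K / real \<alpha> + 1 - (real K / real (r * \<alpha>) - 1) * (real \<delta> - 1)"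
proof -
  define e where "e = \<delta> - 1"
  have \<delta>: "\<delta> = e + 1" and e: "m * r + \<delta> - 1 + \<Delta> = m * r + e + \<Delta>"
    using \<open>\<delta> \<ge> 3\<close> by (auto simp: e_def)
  have reg: "regenerating_code (m * r + e + \<Delta>) (m * r) d \<alpha> \<beta> (m * r * \<alpha>) C'"
    and \<alpha>_eq: "\<alpha> = (d - m * r + 1) * \<beta>"
    using assms(4) unfolding msr_code_def e by auto
  have \<alpha>: "\<alpha> > 0" and d: "m * r \<le> d"
    using reg by (auto simp: regenerating_code_def vector_code_def)
  have C': "C' = vec_space.row_space ((m * r + e + \<Delta>) * \<alpha>) (1\<^sub>m (m * r * \<alpha>) @\<^sub>c Q @\<^sub>c Q')"
    and dim: "dim_col (1\<^sub>m (m * r * \<alpha>) @\<^sub>c Q @\<^sub>c Q') = (m * r + e + \<Delta>) * \<alpha>"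
    using assms(8) unfolding generator_matrix_def e by auto
  have "dim_row (1\<^sub>m (m * r * \<alpha>) @\<^sub>c Q @\<^sub>c Q') = m * r * \<alpha>" by (simp add: append_cols_def)
  then have C'_eq: "C' = encode (1\<^sub>m (m * r * \<alpha>) @\<^sub>c Q @\<^sub>c Q') ` carrier_vec (m * r * \<alpha>)"
    using row_space_eq_encode[OF dim] C' by simp
  interpret msr_generator r m e \<Delta> d \<alpha> \<beta> "m * r * \<alpha>" Q Q'
    using assms \<alpha> reg \<delta> by unfold_locales (auto simp: C'_eq)
  have G: "G = global_gen" by (fact assms(9))
  \<comment> \<open>The block length is forced by the number of columns, since \<alpha> > 0 can be
    cancelled.\<close>
  have n: "n = m * (r + e) + \<Delta>"
    using \<open>dim_col G = n * \<alpha>\<close> global_gen_carrier \<alpha> unfolding G by auto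
  have C: "C = global_code" using assms(11) global_code_row_space unfolding G n by simp
  have K: "K = m * r * \<alpha>" using assms(12) generator_matrix_global(2) unfolding C n by simp
  \<comment> \<open>The truncated difference in \<open>msr_code\<close> is a true one because m r
    \<le> d.\<close>
  have "int \<alpha> = (int d - int (m * r) + 1) * int \<beta>"
    using arg_cong[OF \<alpha>_eq, of int]
    by (simp only: of_nat_mult of_nat_add of_nat_diff[OF d] of_nat_1)
  \<comment> \<open>Here K / \<alpha> = m r and K / (r \<alpha>) = m, so the right-hand side is m e
    + \<Delta> + 1 - (m - 1) e = e + \<Delta> + 1.\<close>
  moreover have "real (min_dist n \<alpha> C) =
      real n - real K / real \<alpha> + 1 - (real K / real (r * \<alpha>) - 1) * (real \<delta> - 1)"
    using \<alpha> \<open>r \<ge> 1\<close> unfolding n C global_min_dist K \<delta> by (simp add: algebra_simps)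
  ultimately show ?thesis
    using generator_matrix_global(1) global_msr_local_code[OF \<alpha>_eq] K
    unfolding n C G \<delta> by simp
qed

end
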